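(* Let $\dot x=f(x,\mu)$, $x\in\mathbb R^n$, be a smooth one-parameter family of systems undergoing a supercritical Hopf bifurcation at $\mu=\mu_c$, with the parameter oriented so that the stable periodic branch exists for $\mu>\mu_c$. For $\mu$ in a neighborhood $J$ of $\mu_c$, let $A_\mu=\{x^*(\mu)\}$ (the stable equilibrium) if $\mu<\mu_c$ and $A_\mu=\Gamma_\mu$ (the stable periodic orbit) if $\mu>\mu_c$. Let $\Phi_\mu$ be the delay-coordinate map into $\mathbb R^m$ with embedding parameters $(\tau,m)$ common to all $\mu$, assume that $\Phi_\mu$ is an embedding on $A_\mu$, and put $M_\mu:=\Phi_\mu(A_\mu)\subset\mathbb R^m$. For $\mu>\mu_c$, let $P_\mu\subset M_\mu$ be a finite set with $d_H(P_\mu,M_\mu)\le\delta_\mu$, let $R_\mu:=\operatorname{rch}(M_\mu)>0$, and assume $\delta_\mu<\frac12\sqrt{3/10}\,R_\mu$; for $\mu<\mu_c$, let $P_\mu=M_\mu$ (a single point). Let $\widetilde X_\mu\subset\mathbb R^m$ be a finite point cloud (the reconstruction from the observed time series) with $d_H(P_\mu,\widetilde X_\mu)\le q_\mu$. Let $\widetilde{\mathcal H}(\mu):=\mathscr H(\widetilde X_\mu)$ and, for $\mu>\mu_c$, $\eta_\mu^{\mathrm{geom}}:=2\left(\sqrt{3/10}\,R_\mu-2\delta_\mu\right)$. Fix $0<\Delta<\rho$ such that the intervals $$K_-=[\mu_c-\rho,\mu_c-\Delta],\qquad K_+=[\mu_c+\Delta,\mu_c+\rho]$$ are contained in $J$,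 and define $$B_-:=\sup_{\mu\in K_-}4q_\mu,\qquad B_+:=\inf_{\mu\in K_+}\left[\eta_\mu^{\mathrm{geom}}-4q_\mu\right].$$ Assume $B_-<\infty$. If $B_-<B_+$, then every threshold $\eta_\Delta\in(B_-,B_+)$ separates the two regimes, that is, $$\widetilde{\mathcal H}(\mu)<\eta_\Delta\quad\text{for all }\mu\in K_-,\qquad \widetilde{\mathcal H}(\mu)>\eta_\Delta\quad\text{for all }\mu\in K_+ .$$
   Context: Supercritical Hopf bifurcation: as $\mu$ crosses $\mu_c$, a pair of complex conjugate eigenvalues of the Jacobian at the equilibrium crosses the imaginary axis with nonzero imaginary part, under the usual nondegeneracy conditions and with negative first Lyapunov coefficient; with the chosen orientation the equilibrium $x^*(\mu)$ is stable for $\mu<\mu_c$, and a stable periodic orbit $\Gamma_\mu$ (a simple closed curve) exists for $\mu>\mu_c$ near $\mu_c$. Delay-coordinate map: given a scalar observation of the state producing the time series $x(t;\mu)$, a delay $\tau>0$ and a dimension $m\ge1$, the delay vectors are $\Phi_\mu(t)=(x(t;\mu),x(t-\tau;\mu),\dots,x(t-(m-1)\tau;\mu))\in\mathbb R^m$; as a map on the attracting set, $\Phi_\mu$ sends a state to the vector of observations of that state evolved backward by $0,\tau,\dots,(m-1)\tau$. "Embedding" means an embedding in the sense of Takens' theorem; in particular $M_\mu$ is a single point for $\mu<\mu_c$ and an embedded simple closed curve for $\mu>\mu_c$. Hausdorff distance for compact $A,B\subset\mathbb R^m$: $d_H(A,B)=\max\{\sup_{a\in A}\inf_{b\in B}\|a-b\|,\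 \sup_{b\in B}\inf_{a\in A}\|a-b\|\}$, with the Euclidean norm. Reach: for compact $K\subset\mathbb R^m$, $\operatorname{rch}(K)$ is the supremum of the $r>0$ such that every point at distance less than $r$ from $K$ has a unique nearest point in $K$. Vietoris--Rips complex: for finite $Y\subset\mathbb R^m$ and $\varepsilon\ge0$, $\mathrm{VR}(Y,\varepsilon)$ is the simplicial complex whose simplices are the nonempty subsets of $Y$ with all pairwise Euclidean distances at most $\varepsilon$. Homology is taken with coefficients in $\mathbb F_2$. $D^{(1)}(Y)=\{(b_i,d_i)\}$ is the degree-one persistence diagram of the filtration $\{\mathrm{VR}(Y,\varepsilon)\}_{\varepsilon\ge0}$. Dominant topological functional: $\mathscr H(Y):=\max_{(b,d)\in D^{(1)}(Y)}(d-b)$, with $\mathscr H(Y)=0$ if $D^{(1)}(Y)$ has no off-diagonal points. *)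

theory Defs
  imports
    "HOL-Analysis.Analysis"
    "HOL-Computational_Algebra.Polynomial"
    "HOL-Library.Z2"
    "HOL-Library.Function_Algebras"
begin

section \<open>Smooth maps\<close>

text \<open>\<open>Ck_on k S f\<close> is meant for open \<open>S\<close>: in finite dimension a differentiable map is of class
  $C^{k+1}$ iff all its directional derivatives are of class $C^k$.\<close>

primrec Ck_on :: "nat \<Rightarrow> 'a::real_normed_vector set \<Rightarrow> ('a \<Rightarrow> 'b::real_normed_vector) \<Rightarrow> bool" where
  "Ck_on 0 S f \<longleftrightarrow> continuous_on S f"
| "Ck_on (Suc k) S f \<longleftrightarrow>
     (\<forall>x\<in>S. f differentiable (at x)) \<and> (\<forall>v. Ck_on k S (\<lambda>x. frechet_derivative f (at x) v))"

definition smooth_on :: "'a::real_normed_vector set \<Rightarrow> ('a \<Rightarrow> 'b::real_normed_vector) \<Rightarrow> bool" where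
  "smooth_on S f \<longleftrightarrow> (\<forall>k. Ck_on k S f)"


section \<open>Autonomous systems, stability, periodic orbits\<close>

definition solution_on :: "real set \<Rightarrow> ('a::real_normed_vector \<Rightarrow> 'a) \<Rightarrow> (real \<Rightarrow> 'a) \<Rightarrow> bool" where
  "solution_on T F x \<longleftrightarrow> (\<forall>t\<in>T. (x has_vector_derivative F (x t)) (at t within T))"

text \<open>The state \<open>p\<close> evolved for time \<open>t\<close> (possibly negative). The field need not be complete; the
  value is meaningful when the solution through \<open>p\<close> is global, as it is for \<open>p\<close> in a compact
  invariant set.\<close>

definition evolve :: "('a::real_normed_vector \<Rightarrow> 'a) \<Rightarrow> real \<Rightarrow> 'a \<Rightarrow> 'a" where
  "evolve F t p = (THE x. solution_on UNIV F x \<and> x 0 = p) t"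

text \<open>Lyapunov stability together with local attraction. Solutions of a smooth field are unique, so
  \<open>\<exists>x\<close> below speaks about \<^emph>\<open>the\<close> forward solution and asserts that it exists for all times.\<close>

definition asymptotically_stable :: "('a::real_normed_vector \<Rightarrow> 'a) \<Rightarrow> 'a set \<Rightarrow> bool" where
  "asymptotically_stable F A \<longleftrightarrow>
     (\<forall>\<epsilon>>0. \<exists>d>0. \<forall>p. infdist p A < d \<longrightarrow>
        (\<exists>x. solution_on {0..} F x \<and> x 0 = p \<and> (\<forall>t\<ge>0. infdist (x t) A < \<epsilon>))) \<and>
     (\<exists>d>0. \<forall>p. infdist p A < d \<longrightarrow>
        (\<exists>x. solution_on {0..} F x \<and> x 0 = p \<and> ((\<lambda>t. infdist (x t) A) \<longlongrightarrow> 0) at_top))"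

definition stable_equilibrium :: "('a::real_normed_vector \<Rightarrow> 'a) \<Rightarrow> 'a \<Rightarrow> bool" where
  "stable_equilibrium F p \<longleftrightarrow> F p = 0 \<and> asymptotically_stable F {p}"

text \<open>Here \<open>T\<close> is the least period, so a periodic orbit is a simple closed curve and not an
  equilibrium.\<close>

definition periodic_orbit :: "('a::real_normed_vector \<Rightarrow> 'a) \<Rightarrow> 'a set \<Rightarrow> bool" where
  "periodic_orbit F C \<longleftrightarrow>
     (\<exists>x T. T > 0 \<and> solution_on UNIV F x \<and> (\<forall>t. x (t + T) = x t) \<and>
            inj_on x {0..<T} \<and> C = x ` {0..<T})"

definition stable_periodic_orbit :: "('a::real_normed_vector \<Rightarrow> 'a) \<Rightarrow> 'a set \<Rightarrow> bool" where
  "stable_periodic_orbit F C \<longleftrightarrow> periodic_orbit F C \<and> asymptotically_stable F C"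


section \<open>Hopf bifurcation\<close>

definition complex_matrix :: "real^'n^'m \<Rightarrow> complex^'n^'m" where
  "complex_matrix A = (\<chi> i j. complex_of_real (A $ i $ j))"

definition eigenvector :: "complex^'n^'n \<Rightarrow> complex \<Rightarrow> complex^'n \<Rightarrow> bool" where
  "eigenvector A z v \<longleftrightarrow> v \<noteq> 0 \<and> A *v v = z *s v"

definition eigenvalue :: "complex^'n^'n \<Rightarrow> complex \<Rightarrow> bool" where
  "eigenvalue A z \<longleftrightarrow> (\<exists>v. eigenvector A z v)"

definition charpoly :: "complex^'n^'n \<Rightarrow> complex poly" where
  "charpoly A = det (mat [:0, 1:] - (\<chi> i j. [:A $ i $ j:]))"

definition simple_eigenvalue :: "complex^'n^'n \<Rightarrow> complex \<Rightarrow> bool" where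
  "simple_eigenvalue A z \<longleftrightarrow> eigenvalue A z \<and> order z (charpoly A) = 1"

definition jac :: "(real^'n \<Rightarrow> real^'n) \<Rightarrow> real^'n \<Rightarrow> complex^'n^'n" where
  "jac F x = complex_matrix (jacobian F (at x))"

definition partial_deriv :: "'n \<Rightarrow> (real^'n \<Rightarrow> real^'n) \<Rightarrow> real^'n \<Rightarrow> real^'n" where
  "partial_deriv j F x = frechet_derivative F (at x) (axis j 1)"

text \<open>The symmetric multilinear forms given by the second and third derivatives of \<open>F\<close> at \<open>x\<close>,
  extended complex-multilinearly.\<close>

definition form2 ::
    "(real^'n \<Rightarrow> real^'n) \<Rightarrow> real^'n \<Rightarrow> complex^'n \<Rightarrow> complex^'n \<Rightarrow> complex^'n" where
  "form2 F x u v = (\<chi> i. \<Sum>j\<in>UNIV. \<Sum>k\<in>UNIV.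
     complex_of_real (partial_deriv j (partial_deriv k F) x $ i) * u $ j * v $ k)"

definition form3 ::
    "(real^'n \<Rightarrow> real^'n) \<Rightarrow> real^'n \<Rightarrow> complex^'n \<Rightarrow> complex^'n \<Rightarrow> complex^'n \<Rightarrow> complex^'n" where
  "form3 F x u v w = (\<chi> i. \<Sum>j\<in>UNIV. \<Sum>k\<in>UNIV. \<Sum>l\<in>UNIV.
     complex_of_real (partial_deriv j (partial_deriv k (partial_deriv l F)) x $ i)
       * u $ j * v $ k * w $ l)"

definition cnj_vec :: "complex^'n \<Rightarrow> complex^'n" where
  "cnj_vec v = (\<chi> i. cnj (v $ i))"

definition hermitian :: "complex^'n \<Rightarrow> complex^'n \<Rightarrow> complex" where
  "hermitian p q = (\<Sum>i\<in>UNIV. cnj (p $ i) * q $ i)"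

text \<open>The first Lyapunov coefficient, in the coordinate-free form of Kuznetsov (Elements of Applied
  Bifurcation Theory): with $A$ the Jacobian and $B$, $C$ the forms of order two and three,
  \<open>A q = i \<omega> q\<close>, \<open>A\<^sup>T p = - i \<omega> p\<close> and \<open>hermitian p q = 1\<close>. Rescaling \<open>q\<close> (and \<open>p\<close> accordingly)
  multiplies it by a positive factor, so its sign is intrinsic.\<close>

definition first_lyapunov ::
    "(real^'n \<Rightarrow> real^'n) \<Rightarrow> real^'n \<Rightarrow> real \<Rightarrow> complex^'n \<Rightarrow> complex^'n \<Rightarrow> real" where
  "first_lyapunov F x \<omega> p q =
     (let A = jac F x; B = form2 F x; C = form3 F x; q' = cnj_vec q in
      1 / (2 * \<omega>) * Re (
          hermitian p (C q q q')
        - 2 * hermitian p (B q (matrix_inv A *v B q q'))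
        + hermitian p (B q' (matrix_inv (mat (2 * \<i> * complex_of_real \<omega>) - A) *v B q q))))"

text \<open>\<open>xs\<close> is the branch of equilibria. The orientation of the parameter is the sign of \<open>Re z'\<close>:
  the critical pair moves from the left to the right half plane.\<close>

definition supercritical_hopf ::
    "(real^'n \<Rightarrow> real \<Rightarrow> real^'n) \<Rightarrow> real \<Rightarrow> (real \<Rightarrow> real^'n) \<Rightarrow> bool" where
  "supercritical_hopf f \<mu>c xs \<longleftrightarrow>
     (\<exists>U. open U \<and> \<mu>c \<in> U \<and> smooth_on U xs \<and> (\<forall>\<mu>\<in>U. f (xs \<mu>) \<mu> = 0)) \<and>
     (let A = (\<lambda>\<mu>. jac (\<lambda>x. f x \<mu>) (xs \<mu>)) in
      \<exists>\<omega>>0.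
        simple_eigenvalue (A \<mu>c) (\<i> * complex_of_real \<omega>) \<and>
        (\<forall>z. eigenvalue (A \<mu>c) z \<and> z \<noteq> \<i> * complex_of_real \<omega> \<and> z \<noteq> - \<i> * complex_of_real \<omega>
              \<longrightarrow> Re z < 0) \<and>
        (\<exists>z z'. z \<mu>c = \<i> * complex_of_real \<omega> \<and>
              (\<forall>\<^sub>F \<mu> in nhds \<mu>c. eigenvalue (A \<mu>) (z \<mu>)) \<and>
              (z has_vector_derivative z') (at \<mu>c) \<and> Re z' > 0) \<and>
        (\<exists>p q. eigenvector (A \<mu>c) (\<i> * complex_of_real \<omega>) q \<and>
              eigenvector (transpose (A \<mu>c)) (- \<i> * complex_of_real \<omega>) p \<and>
              hermitian p q = 1 \<and>
              first_lyapunov (\<lambda>x. f x \<mu>c) (xs \<mu>c) \<omega> p q < 0))"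


section \<open>Delay-coordinate maps and embeddings\<close>

text \<open>The coordinates of \<^typ>\<open>real^'m\<close> are listed in the order of the index type: \<open>j\<close> is the
  coordinate number \<open>card {i. i < j}\<close>, starting from \<open>0\<close>. The time series is \<open>h\<close> along a solution.\<close>

definition delay_map ::
    "real \<Rightarrow> ('a::real_normed_vector \<Rightarrow> real) \<Rightarrow> ('a \<Rightarrow> 'a) \<Rightarrow> 'a \<Rightarrow> real^'m::{finite,linorder}" where
  "delay_map \<tau> h F p = (\<chi> j. h (evolve F (- (real (card {i. i < j}) * \<tau>)) p))"

definition tangent_vectors :: "'a::real_normed_vector set \<Rightarrow> 'a \<Rightarrow> 'a set" where
  "tangent_vectors A p = {v. \<exists>e>0. \<exists>c. smooth_on {-e<..<e} c \<and> c ` {-e<..<e} \<subseteq> A \<and> c 0 = p \<and>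
     (c has_vector_derivative v) (at 0)}"

text \<open>A smooth embedding of a submanifold \<open>A\<close>: a homeomorphism onto the image that is smooth (i.e.
  locally the restriction of a smooth map of the ambient space) and an immersion.\<close>

definition smooth_embedding_on ::
    "'a::real_normed_vector set \<Rightarrow> ('a \<Rightarrow> 'b::real_normed_vector) \<Rightarrow> bool" where
  "smooth_embedding_on A \<Phi> \<longleftrightarrow>
     (\<exists>\<Psi>. homeomorphism A (\<Phi> ` A) \<Phi> \<Psi>) \<and>
     (\<forall>p\<in>A. \<exists>U G. open U \<and> p \<in> U \<and> smooth_on U G \<and> (\<forall>x\<in>A \<inter> U. G x = \<Phi> x) \<and>
        (\<forall>v\<in>tangent_vectors A p. v \<noteq> 0 \<longrightarrow> frechet_derivative G (at p) v \<noteq> 0))"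


section \<open>Hausdorff distance and reach\<close>

text \<open>For nonempty compact sets.\<close>

definition hausdorff_dist :: "'a::metric_space set \<Rightarrow> 'a set \<Rightarrow> real" where
  "hausdorff_dist A B = max (SUP a\<in>A. infdist a B) (SUP b\<in>B. infdist b A)"

text \<open>The value \<open>r = 0\<close>, for which the condition is void, only makes the supremum \<open>0\<close> when no
  positive \<open>r\<close> qualifies. The reach is \<open>\<infinity>\<close> for nonempty closed convex sets.\<close>

definition reach :: "'a::metric_space set \<Rightarrow> ereal" where
  "reach K = Sup (ereal ` {r. 0 \<le> r \<and>
     (\<forall>x. infdist x K < r \<longrightarrow> (\<exists>!y. y \<in> K \<and> (\<forall>z\<in>K. dist x y \<le> dist x z)))})"


section \<open>Vietoris--Rips persistence over the field with two elements\<close>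

definition vietoris_rips :: "'a::metric_space set \<Rightarrow> real \<Rightarrow> 'a set set" where
  "vietoris_rips Y e = {s. s \<noteq> {} \<and> finite s \<and> s \<subseteq> Y \<and> (\<forall>x\<in>s. \<forall>y\<in>s. dist x y \<le> e)}"

definition chain_scale :: "bit \<Rightarrow> ('a set \<Rightarrow> bit) \<Rightarrow> 'a set \<Rightarrow> bit" where
  "chain_scale a c = (\<lambda>s. a * c s)"

global_interpretation chain: vector_space chain_scale
  by standard (auto simp: chain_scale_def fun_eq_iff distrib_left distrib_right mult.assoc)

definition chains :: "nat \<Rightarrow> 'a set set \<Rightarrow> ('a set \<Rightarrow> bit) set" where
  "chains k K = {c. \<forall>s. c s \<noteq> 0 \<longrightarrow> s \<in> K \<and> card s = Suc k}"

text \<open>The coefficient of a face \<open>t\<close> collects its cofaces of one dimension higher. There is no face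
  \<open>{}\<close>, so the boundary of a vertex is \<open>0\<close> (homology is not reduced).\<close>

definition boundary :: "('a set \<Rightarrow> bit) \<Rightarrow> 'a set \<Rightarrow> bit" where
  "boundary c t =
     (if t = {} then 0 else \<Sum>s | c s \<noteq> 0 \<and> t \<subseteq> s \<and> card s = Suc (card t). c s)"

definition cycles :: "nat \<Rightarrow> 'a set set \<Rightarrow> ('a set \<Rightarrow> bit) set" where
  "cycles k K = {c \<in> chains k K. boundary c = 0}"

definition boundaries :: "nat \<Rightarrow> 'a set set \<Rightarrow> ('a set \<Rightarrow> bit) set" where
  "boundaries k K = boundary ` chains (Suc k) K"

text \<open>For \<open>s \<le> t\<close>, the rank of $H_k(K_s) \to H_k(K_t)$, whose image is
  $Z_k(K_s) / (Z_k(K_s) \cap B_k(K_t))$.\<close>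

definition persistent_betti :: "nat \<Rightarrow> (real \<Rightarrow> 'a set set) \<Rightarrow> real \<Rightarrow> real \<Rightarrow> nat" where
  "persistent_betti k K s t =
     chain.dim (cycles k (K s)) - chain.dim (cycles k (K s) \<inter> boundaries k (K t))"

text \<open>Multiplicity of \<open>(b, d)\<close>, \<open>b < d\<close>, in the persistence diagram of degree \<open>k\<close> (in the sense of
  Cohen-Steiner, Edelsbrunner and Harer): the number of classes born in \<open>(b - e, b + e]\<close> and dying
  in \<open>(d - e, d + e]\<close>, for all small \<open>e\<close>.\<close>

definition diagram_mult :: "nat \<Rightarrow> (real \<Rightarrow> 'a set set) \<Rightarrow> real \<Rightarrow> real \<Rightarrow> nat" where
  "diagram_mult k K b d = (THE n. \<forall>\<^sub>F e in at_right 0.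
     int n = (int (persistent_betti k K (b + e) (d - e)) - int (persistent_betti k K (b + e) (d + e)))
           - (int (persistent_betti k K (b - e) (d - e)) - int (persistent_betti k K (b - e) (d + e))))"

text \<open>The off-diagonal points of the degree-one diagram of a finite set \<open>Y\<close>. Every class of degree
  one dies at a finite time, because \<open>vietoris_rips Y e\<close> is a full simplex once \<open>e\<close> reaches the
  diameter of \<open>Y\<close>; hence there are no points at infinity. For \<open>e < 0\<close> the complex is empty, so
  letting the filtration start at \<open>-\<infinity>\<close> adds nothing.\<close>

definition diagram1 :: "'a::metric_space set \<Rightarrow> (real \<times> real) set" where
  "diagram1 Y = {(b, d). b < d \<and> diagram_mult 1 (vietoris_rips Y) b d > 0}"

definition dominant_functional :: "'a::metric_space set \<Rightarrow> real" where
  "dominant_functional Y =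
     (if diagram1 Y = {} then 0 else Max ((\<lambda>(b, d). d - b) ` diagram1 Y))"

end

theory Submission
  imports Defs
begin

text \<open>Why the two regimes separate. Let \<open>X\<close> be the point cloud.

  Before the bifurcation the reconstructed attractor is a point, so \<open>X\<close> lies in a ball of radius
  \<open>q\<close> and its Vietoris--Rips filtration changes only at scales between \<open>0\<close> and
  \<open>2 * q\<close>. No bar is longer than that, and \<open>2 * q \<le> 4 * q < \<eta>\<close>
  (\<open>dominant_functional_le_diameter\<close>).

  After the bifurcation the reconstructed attractor \<open>M\<close> is a simple closed curve, and
  \<open>X\<close> is at Hausdorff distance at most \<open>\<kappa> = \<delta> + q\<close> from it. Let
  \<open>r\<close> be smaller than the reach of \<open>M\<close>. Walking along \<open>M\<close> in small
  steps and moving each stop to a point of \<open>X\<close> gives a closed edge path in \<open>X\<close> with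
  edges barely longer than \<open>2 * \<kappa>\<close>: a cycle that is born by that scale. To see that it
  survives for long, send the tube of radius \<open>r\<close> about \<open>M\<close> to the curve by the
  nearest point map and from there homeomorphically to the unit circle. The resulting map \<open>H\<close> has
  a continuous logarithm on every convex part of the tube, so each edge in the tube has a well-defined angle
  increment, and the increments of the three edges of a triangle in the tube cancel. Every point of a triangle
  with sides at most \<open>t\<close> is within \<open>2/3 * t\<close> of a vertex, so the triangles of the
  complex at scale \<open>t\<close> stay in the tube as long as \<open>\<kappa> + 2/3 * t < r\<close>.
  Subtracting a fixed branch of the argument at the vertices turns the increments into an integral cocycle;
  its value on the edge path is the winding number of the curve, namely \<open>1\<close>. Modulo two, the
  cocycle certifies that the cycle is not a boundary at scale \<open>t\<close>
  (\<open>persistent_loop_near_closed_curve\<close>). The length \<open>2 * sqrt (3/10) * r - 4 *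
  \<kappa>\<close> demanded of the bar leaves room, because \<open>2/3 * (2 * sqrt (3/10)) < 1\<close>.

  That a class alive from \<open>s\<close> to \<open>t\<close> yields a point of the diagram born by \<open>s\<close> and dying
  after \<open>t\<close> is a double telescoping sum (\<open>persistence_bar_exists\<close>): the multiplicities are the mixed
  second differences of the persistent Betti numbers, which vanish before the first scale and, the
  final complex being a cone, after the last.

  The dynamics enters through the attractor: it is a point or a simple closed curve, and the delay
  map carries it homeomorphically onto its image.\<close>


section \<open>Chains with coefficients in the field with two elements\<close>

text \<open>The default simplification of \<^typ>\<open>bit\<close> replaces sums by exclusive or and sums of ones by
  cardinalities; here its elements are to be treated as elements of a field.\<close>

declare add_bit_eq_xor [simp del] mult_bit_eq_and [simp del] bit_not_zero_iff [simp del]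

lemma bit_double: "(a::bit) + a = 0"
  by (cases a) auto

lemma bit_chain_double: "(c :: 'a set \<Rightarrow> bit) + c = 0"
  by (simp add: fun_eq_iff bit_double)

lemma of_int_bit: "(of_int k :: bit) = of_bool (odd k)"
proof (cases "even k")
  case True
  then obtain m where "k = 2 * m" by blast
  then show ?thesis by simp
next
  case False
  then obtain m where "k = 2 * m + 1" by (rule oddE)
  then show ?thesis by simp
qed

text \<open>The only scalars are \<open>0\<close> and \<open>1\<close>, so closure under scaling is automatic.\<close>

lemma subspace_bitI:
  assumes "0 \<in> V" "\<And>c d. c \<in> V \<Longrightarrow> d \<in> V \<Longrightarrow> c + d \<in> V"
  shows "chain.subspace V"
proof (rule chain.subspaceI)
  fix a c assume "c \<in> V"
  then show "chain_scale a c \<in> V"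
    using assms(1) by (cases a) (simp_all add: chain_scale_def zero_fun_def)
qed (use assms in auto)

text \<open>The sum in the definition of \<open>boundary\<close> ranges over the support of the chain; for
  linearity it has to be taken over a common finite set of simplices.\<close>

lemma boundary_on:
  assumes "finite S" "{s. c s \<noteq> 0} \<subseteq> S" "t \<noteq> {}"
  shows "boundary c t = (\<Sum>s | s \<in> S \<and> t \<subseteq> s \<and> card s = Suc (card t). c s)"
  unfolding boundary_def using assms by (auto intro!: sum.mono_neutral_left)

lemma chains_support: "c \<in> chains k K \<Longrightarrow> {s. c s \<noteq> 0} \<subseteq> K"
  by (auto simp: chains_def)

lemma chains_eq_0: "c \<in> chains k K \<Longrightarrow> card s \<noteq> Suc k \<Longrightarrow> c s = 0"
  unfolding chains_def by blast

lemma zero_in_chains: "0 \<in> chains k K"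
  by (simp add: chains_def)

lemma add_in_chains:
  assumes "c \<in> chains k K" "d \<in> chains k K"
  shows "c + d \<in> chains k K"
proof -
  have "c s \<noteq> 0 \<or> d s \<noteq> 0" if "(c + d) s \<noteq> 0" for s
    using that by auto
  then show ?thesis
    using assms unfolding chains_def by blast
qed

lemma sum_in_chains:
  "finite A \<Longrightarrow> (\<And>i. i \<in> A \<Longrightarrow> c i \<in> chains k K) \<Longrightarrow> (\<Sum>i\<in>A. c i) \<in> chains k K"
  by (induction A rule: finite_induct) (auto simp: zero_in_chains add_in_chains)

lemma finite_chains:
  assumes "finite K"
  shows "finite (chains k K)"
proof (rule finite_subset)
  show "chains k K \<subseteq> {c. \<forall>s. (s \<in> K \<longrightarrow> c s \<in> UNIV) \<and> (s \<notin> K \<longrightarrow> c s = 0)}"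
    by (auto simp: chains_def)
  have "b \<in> {0, 1}" for b :: bit by (cases b) auto
  then have "finite (UNIV :: bit set)" by (meson finite.simps finite_subset subsetI)
  then show "finite {c :: 'a set \<Rightarrow> bit. \<forall>s. (s \<in> K \<longrightarrow> c s \<in> UNIV) \<and> (s \<notin> K \<longrightarrow> c s = 0)}"
    by (rule finite_set_of_finite_funs[OF assms])
qed

lemma boundary_zero: "boundary 0 = 0"
  by (rule ext) (simp add: boundary_def)

lemma boundary_add:
  assumes "finite K" "c \<in> chains k K" "d \<in> chains k K"
  shows "boundary (c + d) = boundary c + boundary d"
proof
  fix t
  show "boundary (c + d) t = (boundary c + boundary d) t"
  proof (cases "t = {}")
    case True
    then show ?thesis by (simp add: boundary_def)
  next
    case False
    show ?thesis
      unfolding plus_fun_apply boundary_on[OF assms(1) chains_support[OF assms(2)] False]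
        boundary_on[OF assms(1) chains_support[OF assms(3)] False]
        boundary_on[OF assms(1) chains_support[OF add_in_chains[OF assms(2,3)]] False]
      by (rule sum.distrib)
  qed
qed

lemma boundary_sum:
  assumes "finite K" "finite A" "\<And>i. i \<in> A \<Longrightarrow> c i \<in> chains k K"
  shows "boundary (\<Sum>i\<in>A. c i) = (\<Sum>i\<in>A. boundary (c i))"
  using assms(2,3)
proof (induction A rule: finite_induct)
  case empty
  then show ?case by (simp only: sum.empty boundary_zero)
next
  case (insert i A)
  have "boundary (c i + (\<Sum>i\<in>A. c i)) = boundary (c i) + boundary (\<Sum>i\<in>A. c i)"
  proof (rule boundary_add[OF assms(1)])
    show "c i \<in> chains k K" by (rule insert.prems) simp
    show "(\<Sum>i\<in>A. c i) \<in> chains k K"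
      by (rule sum_in_chains[OF insert.hyps(1)]) (rule insert.prems, simp)
  qed
  also have "boundary (\<Sum>i\<in>A. c i) = (\<Sum>i\<in>A. boundary (c i))"
    by (rule insert.IH) (rule insert.prems, simp)
  finally show ?case
    by (simp only: sum.insert[OF insert.hyps])
qed

lemma subspace_cycles: "finite K \<Longrightarrow> chain.subspace (cycles k K)"
  by (rule subspace_bitI)
    (auto simp: cycles_def zero_in_chains boundary_zero add_in_chains boundary_add)

lemma subspace_boundaries:
  assumes "finite K"
  shows "chain.subspace (boundaries k K)"
proof (rule subspace_bitI)
  show "0 \<in> boundaries k K"
    unfolding boundaries_def using zero_in_chains boundary_zero by (metis imageI)
  fix c d assume "c \<in> boundaries k K" "d \<in> boundaries k K"
  then obtain c' d' where "c' \<in> chains (Suc k) K" "d' \<in> chains (Suc k) K"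
    "c = boundary c'" "d = boundary d'" unfolding boundaries_def by blast
  then show "c + d \<in> boundaries k K"
    unfolding boundaries_def using boundary_add[OF assms] add_in_chains by (metis imageI)
qed

text \<open>Chains live in an infinite-dimensional space of functions, where dimension is meaningful only
  for finitely generated subspaces. Over \<^typ>\<open>bit\<close> the spaces of interest are even finite as sets.\<close>

lemma chain_dim_strict_mono:
  assumes W: "chain.subspace W" and "W \<subseteq> V" "finite V" "z \<in> V" "z \<notin> W"
  shows "chain.dim W < chain.dim V"
proof -
  \<comment> \<open>Extend a basis of \<open>W\<close> together with \<open>z\<close> to a basis of \<open>V\<close>.\<close>
  obtain B where B: "B \<subseteq> W" "chain.independent B" "W \<subseteq> chain.span B" "card B = chain.dim W"
    by (rule chain.basis_exists)
  have "chain.span B = W"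
    using B W by (meson chain.span_minimal subset_antisym)
  then have ind: "chain.independent (insert z B)"
    using B(2) \<open>z \<notin> W\<close> chain.span_base[of z B]
    by (auto simp: chain.independent_insert)
  have sub: "insert z B \<subseteq> V" using B(1) assms by auto
  obtain B' where B': "insert z B \<subseteq> B'" "B' \<subseteq> V" "chain.independent B'" "V \<subseteq> chain.span B'"
    using chain.maximal_independent_subset_extend[OF sub ind] by blast
  have "finite B'" using B'(2) \<open>finite V\<close> finite_subset by blast
  have "card (insert z B) = Suc (card B)"
    using B(1) \<open>z \<notin> W\<close> \<open>finite V\<close> sub finite_subset
    by (metis card_insert_disjoint finite_insert subsetD)
  moreover have "card (insert z B) \<le> card B'"
    using B'(1) \<open>finite B'\<close> by (rule card_mono[rotated])
  moreover have "card B' = chain.dim V"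
    using B' chain.basis_card_eq_dim by blast
  ultimately show ?thesis using B(4) by simp
qed

lemma persistent_betti_pos:
  assumes "finite (K s)" "finite (K t)" "z \<in> cycles k (K s)" "z \<notin> boundaries k (K t)"
  shows "persistent_betti k K s t > 0"
proof -
  have "chain.dim (cycles k (K s) \<inter> boundaries k (K t)) < chain.dim (cycles k (K s))"
  proof (rule chain_dim_strict_mono)
    show "chain.subspace (cycles k (K s) \<inter> boundaries k (K t))"
      using assms(1,2) by (intro chain.subspace_inter subspace_cycles subspace_boundaries)
    show "finite (cycles k (K s))"
      using finite_chains[OF assms(1), of k] by (rule finite_subset[rotated]) (auto simp: cycles_def)
  qed (use assms in auto)
  then show ?thesis by (simp add: persistent_betti_def)
qed

lemma persistent_betti_eq_0:
  "cycles k (K s) \<subseteq> boundaries k (K t) \<Longrightarrow> persistent_betti k K s t = 0"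
  by (simp add: persistent_betti_def Int_absorb2)

text \<open>A cycle \<open>c\<close> is the boundary of the cone over \<open>c\<close> with apex \<open>p\<close>. On edges that avoid \<open>p\<close> this
  is immediate; on an edge \<open>{p, v}\<close> the boundary of the cone collects the edges of \<open>c\<close> at \<open>v\<close> other
  than \<open>{p, v}\<close>, and their sum is the coefficient of \<open>{p, v}\<close> since \<open>c\<close> has no boundary at \<open>v\<close>.\<close>

lemma cycle_is_boundary_of_cone:
  assumes "finite K" and cone: "\<And>s. s \<in> K \<Longrightarrow> card s = 2 \<Longrightarrow> insert p s \<in> K"
  shows "cycles 1 K \<subseteq> boundaries 1 K"
proof
  fix c assume "c \<in> cycles 1 K"
  then have c: "c \<in> chains 1 K" and bc: "boundary c = 0" by (auto simp: cycles_def)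
  define d where "d = (\<lambda>T. if p \<in> T \<and> card T = 3 then c (T - {p}) else 0)"
  have d: "d \<in> chains 2 K"
    unfolding chains_def
  proof clarify
    fix T assume "d T \<noteq> 0"
    then have *: "p \<in> T" "card T = 3" "c (T - {p}) \<noteq> 0" by (auto simp: d_def split: if_splits)
    then have "T - {p} \<in> K \<and> card (T - {p}) = Suc 1" using c unfolding chains_def by blast
    then have "T - {p} \<in> K" "card (T - {p}) = 2" by (simp_all add: numeral_2_eq_2)
    then have "insert p (T - {p}) \<in> K" by (rule cone)
    then show "T \<in> K \<and> card T = Suc 2" using * by (simp add: insert_absorb)
  qed
  have "boundary d t = c t" for t
  proof (cases "card t = 2")
    case False
    have "d T = 0" if "card T = Suc (card t)" for T
      using that False by (auto simp: d_def)
    then show ?thesis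
      using False chains_eq_0[OF c, of t] by (auto simp: boundary_def intro!: sum.neutral)
  next
    case True
    then have [simp]: "t \<noteq> {}" and fin: "finite t" by (auto intro: card_ge_0_finite)
    have bd: "boundary d t = (\<Sum>T | d T \<noteq> 0 \<and> t \<subseteq> T \<and> card T = 3. d T)"
      by (simp add: boundary_def True numeral_3_eq_3 numeral_2_eq_2)
    show ?thesis
    proof (cases "p \<in> t")
      case False
      have "T = insert p t" if "d T \<noteq> 0" "t \<subseteq> T" "card T = 3" for T
      proof -
        have "p \<in> T" using that(1) by (auto simp: d_def split: if_splits)
        moreover have "finite T" using that(3) by (auto intro: card_ge_0_finite)
        moreover have "card (insert p t) = card T" using True False fin that(3) by simp
        ultimately show ?thesis using that(2) card_subset_eq[of T "insert p t"] by simp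
      qed
      then have "{T. d T \<noteq> 0 \<and> t \<subseteq> T \<and> card T = 3} \<subseteq> {insert p t}" by blast
      then have "boundary d t = (\<Sum>T\<in>{insert p t}. d T)"
        unfolding bd using True False fin by (intro sum.mono_neutral_left) auto
      also have "\<dots> = c t"
        using True False fin by (simp add: d_def)
      finally show ?thesis .
    next
      case True2: True
      then obtain v where v: "t = {p, v}" "p \<noteq> v"
      proof -
        obtain a b where "t = {a, b}" "a \<noteq> b" using True by (auto simp: card_2_iff)
        then have "t = {p, b} \<and> p \<noteq> b \<or> t = {p, a} \<and> p \<noteq> a" using True2 by auto
        then show thesis using that by blast
      qed
      let ?E = "{s. c s \<noteq> 0 \<and> {v} \<subseteq> s \<and> card s = 2}"
      have finE: "finite ?E"
        using c \<open>finite K\<close> by (auto simp: chains_def intro: finite_subset[of _ K])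
      have rest: "boundary d t = (\<Sum>s\<in>?E - {t}. c s)"
        unfolding bd
      proof (rule sum.reindex_bij_witness[where i = "insert p" and j = "\<lambda>T. T - {p}"])
        fix T assume "T \<in> {T. d T \<noteq> 0 \<and> t \<subseteq> T \<and> card T = 3}"
        then have T: "d T \<noteq> 0" "t \<subseteq> T" "card T = 3" by auto
        then have "p \<in> T" "v \<in> T" using v by auto
        moreover from this T have "d T = c (T - {p})" by (simp add: d_def)
        moreover have "p \<in> t" using v by simp
        ultimately show "insert p (T - {p}) = T" "T - {p} \<in> ?E - {t}" "c (T - {p}) = d T"
          using T(1,3) v(2) by auto
      next
        fix s assume "s \<in> ?E - {t}"
        then have s: "c s \<noteq> 0" "v \<in> s" "card s = 2" "s \<noteq> t" by auto
        then have fs: "finite s" by (simp add: card_ge_0_finite)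
        have "p \<notin> s"
        proof
          assume "p \<in> s"
          then have "t \<subseteq> s" using s(2) v(1) by auto
          then have "t = s" using fs s(3) True by (simp add: card_subset_eq)
          then show False using s(4) by simp
        qed
        then have *: "insert p s - {p} = s" "card (insert p s) = 3" using fs s(3) by auto
        then have "d (insert p s) = c s" unfolding d_def by simp
        then show "insert p s - {p} = s" "insert p s \<in> {T. d T \<noteq> 0 \<and> t \<subseteq> T \<and> card T = 3}"
          using s(1,2) v(1) * by auto
      qed
      have split: "c t + (\<Sum>s\<in>?E - {t}. c s) = (\<Sum>s\<in>?E. c s)"
      proof (cases "c t = 0")
        case True
        then have "?E - {t} = ?E" by blast
        then show ?thesis using True by simp
      next
        case False
        then have "t \<in> ?E" using v(1) True by blast
        then show ?thesis by (rule sum.remove[OF finE, symmetric])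
      qed
      have "(\<Sum>s\<in>?E. c s) = boundary c {v}"
        by (simp add: boundary_def numeral_2_eq_2)
      then have "c t + boundary d t = 0" unfolding rest split bc by simp
      then show ?thesis
        by (cases "c t"; cases "boundary d t") auto
    qed
  qed
  then have "c = boundary d" by auto
  moreover have "d \<in> chains (Suc 1) K" using d by (simp add: numeral_2_eq_2)
  ultimately show "c \<in> boundaries 1 K" unfolding boundaries_def by blast
qed


section \<open>Detecting a loop by a cocycle\<close>

text \<open>Stokes: evaluating \<open>\<phi>\<close> on the boundary of a chain of triangles means evaluating the coboundary
  of \<open>\<phi>\<close> on the triangles.\<close>

lemma cocycle_kills_boundary:
  fixes \<phi> :: "'a set \<Rightarrow> bit"
  assumes "finite K"
    and faces: "\<And>s T. T \<in> K \<Longrightarrow> s \<subseteq> T \<Longrightarrow> s \<noteq> {} \<Longrightarrow> s \<in> K"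
    and cocycle: "\<And>T. T \<in> K \<Longrightarrow> card T = 3 \<Longrightarrow> (\<Sum>s | s \<subseteq> T \<and> card s = 2. \<phi> s) = 0"
    and "c \<in> boundaries 1 K"
  shows "(\<Sum>s | s \<in> K \<and> card s = 2. \<phi> s * c s) = 0"
proof -
  obtain d where d: "d \<in> chains 2 K" "c = boundary d"
    using assms(4) by (auto simp: boundaries_def numeral_2_eq_2)
  let ?E = "{s. s \<in> K \<and> card s = 2}" and ?T = "{T. T \<in> K \<and> card T = 3}"
  have c: "c s = (\<Sum>T | T \<in> ?T \<and> s \<subseteq> T. d T)" if "s \<in> ?E" for s
  proof -
    have "s \<noteq> {}" using that by auto
    show ?thesis
      unfolding d(2) boundary_on[OF assms(1) chains_support[OF d(1)] \<open>s \<noteq> {}\<close>]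
      by (rule sum.cong) (use that in auto)
  qed
  have "(\<Sum>s\<in>?E. \<phi> s * c s) = (\<Sum>s\<in>?E. \<Sum>T | T \<in> ?T \<and> s \<subseteq> T. \<phi> s * d T)"
    using c by (simp add: sum_distrib_left)
  also have "\<dots> = (\<Sum>T\<in>?T. \<Sum>s | s \<in> ?E \<and> s \<subseteq> T. \<phi> s * d T)"
    by (rule sum.swap_restrict) (use assms(1) in auto)
  also have "\<dots> = 0"
  proof (rule sum.neutral, rule ballI)
    fix T assume T: "T \<in> ?T"
    have "s \<in> K" if "s \<subseteq> T" "card s = 2" for s
      by (rule faces[of T]) (use T that in auto)
    then have "{s. s \<in> ?E \<and> s \<subseteq> T} = {s. s \<subseteq> T \<and> card s = 2}"
      by blast
    then show "(\<Sum>s | s \<in> ?E \<and> s \<subseteq> T. \<phi> s * d T) = 0"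
      using cocycle T by (simp flip: sum_distrib_right)
  qed
  finally show ?thesis .
qed

text \<open>A degenerate edge is the zero chain, so that an edge path may repeat a vertex.\<close>

definition edge :: "'a \<Rightarrow> 'a \<Rightarrow> 'a set \<Rightarrow> bit" where
  "edge x y = (\<lambda>s. of_bool (x \<noteq> y \<and> s = {x, y}))"

definition vertex :: "'a \<Rightarrow> 'a set \<Rightarrow> bit" where
  "vertex x = (\<lambda>s. of_bool (s = {x}))"

lemma edge_in_chains: "{x, y} \<in> K \<Longrightarrow> edge x y \<in> chains 1 K"
  by (auto simp: edge_def chains_def)

lemma boundary_edge: "boundary (edge x y) = vertex x + vertex y"
proof (cases "x = y")
  case True
  then have "edge x y = 0" by (auto simp: edge_def)
  then show ?thesis using True by (simp add: boundary_zero bit_chain_double)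
next
  case False
  show ?thesis
  proof
    fix t :: "'a set"
    have *: "{s. edge x y s \<noteq> 0 \<and> t \<subseteq> s \<and> card s = Suc (card t)} =
        (if t = {x} \<or> t = {y} then {{x, y}} else {})" if "t \<noteq> {}"
    proof -
      have "t = {x} \<or> t = {y}" if "t \<subseteq> {x, y}" "card {x, y} = Suc (card t)"
      proof -
        have "card t = 1" using that(2) False by simp
        then obtain u where "t = {u}" by (auto simp: card_1_singleton_iff)
        then show ?thesis using that(1) by auto
      qed
      then show ?thesis using False by (auto simp: edge_def)
    qed
    have "boundary (edge x y) t = of_bool (t = {x} \<or> t = {y})"
    proof (cases "t = {}")
      case True
      then show ?thesis by (simp add: boundary_def)
    next
      case nonempty: False
      have "boundary (edge x y) t = (\<Sum>s\<in>(if t = {x} \<or> t = {y} then {{x, y}} else {}). edge x y s)"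
        unfolding boundary_def *[OF nonempty] using nonempty by (simp only: if_False)
      then show ?thesis using False by (simp add: edge_def)
    qed
    also have "\<dots> = vertex x t + vertex y t"
      using False by (auto simp: vertex_def)
    finally show "boundary (edge x y) t = (vertex x + vertex y) t" by simp
  qed
qed

lemma finite_vietoris_rips: "finite Y \<Longrightarrow> finite (vietoris_rips Y e)"
  by (rule finite_subset[of _ "Pow Y"]) (auto simp: vietoris_rips_def)

lemma edge_in_vietoris_rips:
  "x \<in> Y \<Longrightarrow> y \<in> Y \<Longrightarrow> dist x y \<le> e \<Longrightarrow> {x, y} \<in> vietoris_rips Y e"
proof -
  assume "x \<in> Y" "y \<in> Y" "dist x y \<le> e"
  moreover then have "0 \<le> e" using zero_le_dist order_trans by blast
  ultimately show ?thesis by (auto simp: vietoris_rips_def dist_commute)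
qed

text \<open>Read modulo two, an integral cocycle \<open>n\<close> on oriented edges does not depend on the orientation
  and becomes a cocycle with values in \<^typ>\<open>bit\<close>. A closed edge path on which it is odd is not a
  boundary. The cocycle identity is required for degenerate triangles too; these give
  \<open>n u u = 0\<close> and \<open>n v u = - n u v\<close>.\<close>

lemma persistent_betti_loop:
  fixes Y :: "'a::metric_space set" and x :: "nat \<Rightarrow> 'a" and n :: "'a \<Rightarrow> 'a \<Rightarrow> int"
  assumes "finite Y" "s \<le> t"
    and x: "\<And>i. i \<le> N \<Longrightarrow> x i \<in> Y" "\<And>i. i < N \<Longrightarrow> dist (x i) (x (Suc i)) \<le> s" "x N = x 0"
    and n: "\<And>u v w. \<lbrakk>u \<in> Y; v \<in> Y; w \<in> Y; dist u v \<le> t; dist v w \<le> t; dist u w \<le> t\<rbrakk>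
              \<Longrightarrow> n u v + n v w = n u w"
    and odd: "odd (\<Sum>i<N. n (x i) (x (Suc i)))"
  shows "persistent_betti 1 (vietoris_rips Y) s t > 0"
proof -
  let ?K = "vietoris_rips Y"
  define z where "z = (\<Sum>i<N. edge (x i) (x (Suc i)))"
  have step: "{x i, x (Suc i)} \<in> ?K s" if "i < N" for i
    using that x by (intro edge_in_vietoris_rips) auto
  then have chain: "edge (x i) (x (Suc i)) \<in> chains 1 (?K s)" if "i < N" for i
    using that by (intro edge_in_chains)
  have "N \<noteq> 0" using odd by (intro notI) simp
  then have "0 \<le> t"
    using x(2)[of 0] \<open>s \<le> t\<close> by (meson dual_order.trans not_gr_zero zero_le_dist)
  have fin: "finite (?K e)" for e using \<open>finite Y\<close> by (rule finite_vietoris_rips)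
  have "boundary z = (\<Sum>i<N. boundary (edge (x i) (x (Suc i))))"
    unfolding z_def by (rule boundary_sum[OF fin]) (use chain in auto)
  also have "\<dots> = (\<Sum>i<N. vertex (x i) + vertex (x (Suc i)))"
    by (simp only: boundary_edge)
  also have "\<dots> = (\<Sum>i<N. vertex (x i)) + (\<Sum>i<N. vertex (x (Suc i)))"
    by (rule sum.distrib)
  also have "(\<Sum>i<N. vertex (x (Suc i))) = (\<Sum>i<N. vertex (x i))"
  proof -
    have "vertex (x 0) + (\<Sum>i<N. vertex (x (Suc i))) = (\<Sum>i<N. vertex (x i)) + vertex (x N)"
      using sum.lessThan_Suc_shift[of "\<lambda>i. vertex (x i)" N] by simp
    then show ?thesis using x(3) by (simp add: add.commute)
  qed
  finally have "boundary z = 0" by (simp only: bit_chain_double)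
  moreover have "z \<in> chains 1 (?K s)"
    unfolding z_def by (rule sum_in_chains) (use chain in auto)
  ultimately have z: "z \<in> cycles 1 (?K s)" by (simp add: cycles_def)

  \<comment> \<open>On edges of length at most \<open>t\<close> the parity of \<open>n\<close> does not depend on the orientation.\<close>
  define \<phi> :: "'a set \<Rightarrow> bit" where
    "\<phi> s = of_bool (\<exists>u v. u \<in> Y \<and> v \<in> Y \<and> s = {u, v} \<and> odd (n u v))" for s
  have n_refl: "n u u = 0" if "u \<in> Y" for u
    using n[of u u u] that \<open>0 \<le> t\<close> by simp
  have sym: "n v u = - n u v" if "u \<in> Y" "v \<in> Y" "dist u v \<le> t" for u v
    using n[of u v u] n_refl[of u] that \<open>0 \<le> t\<close> by (simp add: dist_commute)
  have \<phi>: "\<phi> {u, v} = of_int (n u v)" if "u \<in> Y" "v \<in> Y" "dist u v \<le> t" for u v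
    using that sym[OF that] by (auto simp: \<phi>_def of_int_bit doubleton_eq_iff)
  have "z \<notin> boundaries 1 (?K t)"
  proof
    assume "z \<in> boundaries 1 (?K t)"
    then have zero: "(\<Sum>s | s \<in> ?K t \<and> card s = 2. \<phi> s * z s) = 0"
    proof (rule cocycle_kills_boundary[OF fin, rotated 2])
      show "s \<in> ?K t" if "T \<in> ?K t" "s \<subseteq> T" "s \<noteq> {}" for s T
        using that finite_subset[of s T] by (auto simp: vietoris_rips_def)
      fix T assume "T \<in> ?K t" "card T = 3"
      then obtain u v w where T: "T = {u, v, w}" "u \<noteq> v" "v \<noteq> w" "u \<noteq> w"
        by (auto simp: card_3_iff)
      have *: "u \<in> Y" "v \<in> Y" "w \<in> Y" "dist u v \<le> t" "dist v w \<le> t" "dist u w \<le> t"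
        using \<open>T \<in> ?K t\<close> T by (auto simp: vietoris_rips_def)
      have "{s. s \<subseteq> T \<and> card s = 2} = {{u, v}, {v, w}, {u, w}}"
        unfolding T(1) using T(2-4) by (auto simp: card_2_iff doubleton_eq_iff)
      then have "(\<Sum>s | s \<subseteq> T \<and> card s = 2. \<phi> s) = \<phi> {u, v} + \<phi> {v, w} + \<phi> {u, w}"
        using T(2-4) by (simp add: doubleton_eq_iff add.assoc)
      also have "\<dots> = of_int (n u v + n v w + n u w)"
        using * by (simp add: \<phi>)
      also have "\<dots> = 0"
        using n[OF *] by (simp add: bit_double)
      finally show "(\<Sum>s | s \<subseteq> T \<and> card s = 2. \<phi> s) = 0" .
    qed
    have "(\<Sum>s | s \<in> ?K t \<and> card s = 2. \<phi> s * z s) =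
        (\<Sum>i<N. \<Sum>s | s \<in> ?K t \<and> card s = 2. \<phi> s * edge (x i) (x (Suc i)) s)"
    proof -
      have "z s = (\<Sum>i<N. edge (x i) (x (Suc i)) s)" for s
        unfolding z_def by (induction N) auto
      then show ?thesis
        by (simp add: sum_distrib_left sum.swap[of _ "{..<N}"])
    qed
    also have "\<dots> = (\<Sum>i<N. of_int (n (x i) (x (Suc i))))"
    proof (rule sum.cong[OF refl])
      fix i assume "i \<in> {..<N}"
      then have i: "x i \<in> Y" "x (Suc i) \<in> Y" "dist (x i) (x (Suc i)) \<le> t"
        using x(1)[of i] x(1)[of "Suc i"] x(2)[of i] \<open>s \<le> t\<close> by auto
      show "(\<Sum>s | s \<in> ?K t \<and> card s = 2. \<phi> s * edge (x i) (x (Suc i)) s) =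
          of_int (n (x i) (x (Suc i)))"
      proof (cases "x i = x (Suc i)")
        case True
        then show ?thesis using n_refl[OF i(1)] by (simp add: edge_def)
      next
        case False
        have "(\<Sum>s | s \<in> ?K t \<and> card s = 2. \<phi> s * edge (x i) (x (Suc i)) s) =
            (\<Sum>s\<in>{{x i, x (Suc i)}}. \<phi> s * edge (x i) (x (Suc i)) s)"
          using fin[of t] edge_in_vietoris_rips[OF i] False
          by (intro sum.mono_neutral_right) (auto simp: edge_def)
        then show ?thesis using False \<phi>[OF i] by (simp add: edge_def)
      qed
    qed
    also have "\<dots> = of_int (\<Sum>i<N. n (x i) (x (Suc i)))" by simp
    finally show False using zero odd by (simp add: of_int_bit del: of_int_sum)
  qed
  then show ?thesis using persistent_betti_pos[of "vietoris_rips Y" s t z 1, OF fin fin z] by blast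
qed


section \<open>From persistent Betti numbers to the persistence diagram\<close>

text \<open>Right-continuous step functions with jumps in \<open>C\<close> only.\<close>

definition step_on :: "real set \<Rightarrow> (real \<Rightarrow> 'b) \<Rightarrow> bool" where
  "step_on C F \<longleftrightarrow> (\<forall>x y. x \<le> y \<and> C \<inter> {x<..y} = {} \<longrightarrow> F x = F y)"

lemma step_onD:
  assumes "step_on C F" "x \<le> y" "\<And>c. c \<in> C \<Longrightarrow> x < c \<Longrightarrow> c \<le> y \<Longrightarrow> False"
  shows "F x = F y"
proof -
  have "C \<inter> {x<..y} = {}" using assms(3) by force
  then show ?thesis using assms(1,2) unfolding step_on_def by blast
qed

text \<open>If \<open>e\<close> is smaller than all gaps of \<open>C\<close>, then \<open>F (c - e)\<close> is the left limit of \<open>F\<close> at \<open>c\<close>, and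
  the increments of \<open>F\<close> across its jumps telescope.\<close>

lemma sum_of_jumps:
  fixes F :: "real \<Rightarrow> int"
  assumes "finite C" "step_on C F" "0 < e"
    and sep: "\<And>c c'. c \<in> C \<Longrightarrow> c' \<in> C \<Longrightarrow> c' < c \<Longrightarrow> c' < c - e"
    and "u \<le> v"
  shows "(\<Sum>c\<in>C \<inter> {u<..v}. F c - F (c - e)) = F v - F u"
  using \<open>u \<le> v\<close>
proof (induction "card (C \<inter> {u<..v})" arbitrary: v)
  case 0
  then have empty: "C \<inter> {u<..v} = {}" using \<open>finite C\<close> by simp
  then have "F u = F v" using assms(2) 0(2) unfolding step_on_def by blast
  then show ?case unfolding empty by simp
next
  case (Suc k)
  let ?S = "C \<inter> {u<..v}"
  define c where "c = Max ?S"
  have fin: "finite ?S" using \<open>finite C\<close> by simp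
  have "?S \<noteq> {}" using Suc(2) by auto
  then have c: "c \<in> C" "u < c" "c \<le> v" and le: "\<And>c'. c' \<in> ?S \<Longrightarrow> c' \<le> c"
    using Max_in[OF fin] Max_ge[OF fin] unfolding c_def by auto
  have Fv: "F c = F v"
    by (rule step_onD[OF assms(2) c(3)]) (use le c in fastforce)
  \<comment> \<open>Split off the last jump \<open>c\<close>; the interval may begin inside the gap to its left.\<close>
  define w where "w = max u (c - e)"
  have Fw: "F w = F (c - e)"
  proof (cases "u \<le> c - e")
    case False
    then have "c - e \<le> u" by simp
    then have "F (c - e) = F u"
      by (rule step_onD[OF assms(2)]) (use sep[OF c(1)] c(2) in fastforce)
    then show ?thesis using False by (simp add: w_def)
  qed (simp add: w_def)
  have S: "?S = insert c (C \<inter> {u<..w})"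
  proof -
    have "x \<le> w" if "x \<in> ?S" "x \<noteq> c" for x
      using sep[OF c(1), of x] le[OF that(1)] that by (auto simp: w_def)
    moreover have "w < c" using c(2) \<open>0 < e\<close> by (simp add: w_def)
    ultimately show ?thesis using c by fastforce
  qed
  have nin: "c \<notin> C \<inter> {u<..w}" using c(2) \<open>0 < e\<close> by (auto simp: w_def)
  have "u \<le> w" by (simp add: w_def)
  moreover have "k = card (C \<inter> {u<..w})"
    using Suc(2) nin \<open>finite C\<close> unfolding S by simp
  ultimately have "(\<Sum>c\<in>C \<inter> {u<..w}. F c - F (c - e)) = F w - F u"
    using Suc(1) by blast
  then show ?case
    unfolding S using nin \<open>finite C\<close> Fv Fw by simp
qed

lemma eventually_small_positive: "0 < r \<Longrightarrow> \<forall>\<^sub>F e in at_right (0::real). 0 < e \<and> e < r"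
  by (auto simp: eventually_at_right_field intro: exI[of _ r])

lemma finite_separation:
  fixes C :: "real set"
  assumes "finite C"
  obtains e where "0 < e" "\<And>c c'. c \<in> C \<Longrightarrow> c' \<in> C \<Longrightarrow> c' < c \<Longrightarrow> c' < c - e"
proof -
  have "\<forall>\<^sub>F e in at_right 0. \<forall>c\<in>C. \<forall>c'\<in>C. c' < c \<longrightarrow> c' < c - e"
  proof (intro eventually_ball_finite assms ballI)
    fix c c' assume "c \<in> C" "c' \<in> C"
    show "\<forall>\<^sub>F e in at_right 0. c' < c \<longrightarrow> c' < c - e"
    proof (cases "c' < c")
      case True
      then have "\<forall>\<^sub>F e in at_right (0::real). 0 < e \<and> e < c - c'"
        by (intro eventually_small_positive) simp
      then show ?thesis by eventually_elim auto
    qed simp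
  qed
  then have "\<forall>\<^sub>F e in at_right (0::real). 0 < e \<and> (\<forall>c\<in>C. \<forall>c'\<in>C. c' < c \<longrightarrow> c' < c - e)"
    using eventually_at_right_less[of "0::real"] by eventually_elim auto
  then obtain e where "0 < e" "\<forall>c\<in>C. \<forall>c'\<in>C. c' < c \<longrightarrow> c' < c - e"
    using eventually_happens' trivial_limit_at_right_real by blast
  then show thesis using that by blast
qed

lemma eventually_step_right:
  assumes "finite C" "step_on C F"
  shows "\<forall>\<^sub>F e in at_right 0. F (x + e) = F x"
proof -
  obtain r where r: "0 < r" "\<And>c c'. c \<in> insert x C \<Longrightarrow> c' \<in> insert x C \<Longrightarrow> c' < c \<Longrightarrow> c' < c - r"
    using finite_separation[of "insert x C"] assms(1) by auto
  from eventually_small_positive[OF r(1)] show ?thesis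
  proof eventually_elim
    case (elim e)
    have "F x = F (x + e)"
      by (rule step_onD[OF assms(2)]) (use elim r(2)[of _ x] in fastforce)+
    then show ?case by simp
  qed
qed

lemma eventually_step_left:
  assumes "finite C" "step_on C F" "x \<notin> C"
  shows "\<forall>\<^sub>F e in at_right 0. F (x - e) = F x"
proof -
  obtain r where r: "0 < r" "\<And>c c'. c \<in> insert x C \<Longrightarrow> c' \<in> insert x C \<Longrightarrow> c' < c \<Longrightarrow> c' < c - r"
    using finite_separation[of "insert x C"] assms(1) by auto
  from eventually_small_positive[OF r(1)] show ?thesis
  proof eventually_elim
    case (elim e)
    have "False" if "c \<in> C" "x - e < c" "c \<le> x" for c
      using r(2)[of x c] that assms(3) elim by (cases "c = x") auto
    then show ?case
      using elim by (intro step_onD[OF assms(2)]) auto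
  qed
qed

lemma diagram_mult_eqI:
  assumes "\<forall>\<^sub>F e in at_right 0.
     int n = (int (persistent_betti k K (b + e) (d - e)) - int (persistent_betti k K (b + e) (d + e)))
           - (int (persistent_betti k K (b - e) (d - e)) - int (persistent_betti k K (b - e) (d + e)))"
  shows "diagram_mult k K b d = n"
  unfolding diagram_mult_def
proof (rule the_equality, rule assms)
  fix m assume "\<forall>\<^sub>F e in at_right 0.
     int m = (int (persistent_betti k K (b + e) (d - e)) - int (persistent_betti k K (b + e) (d + e)))
           - (int (persistent_betti k K (b - e) (d - e)) - int (persistent_betti k K (b - e) (d + e)))"
  with assms have "\<forall>\<^sub>F e in at_right (0::real). m = n" by eventually_elim linarith
  then show "m = n" by (simp add: eventually_const_iff)
qed

text \<open>If nothing happens at \<open>b\<close>, the two rows of the second difference agree; likewise for \<open>d\<close> and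
  the columns.\<close>

lemma diagram_mult_noncritical:
  assumes "finite C" "step_on C K" "b \<notin> C \<or> d \<notin> C"
  shows "diagram_mult k K b d = 0"
proof (rule diagram_mult_eqI)
  show "\<forall>\<^sub>F e in at_right 0.
     int 0 = (int (persistent_betti k K (b + e) (d - e)) - int (persistent_betti k K (b + e) (d + e)))
           - (int (persistent_betti k K (b - e) (d - e)) - int (persistent_betti k K (b - e) (d + e)))"
    using assms(3)
  proof
    assume "b \<notin> C"
    from eventually_step_left[OF assms(1,2) this] eventually_step_right[OF assms(1,2), of b]
    show ?thesis by eventually_elim (simp add: persistent_betti_def)
  next
    assume "d \<notin> C"
    from eventually_step_left[OF assms(1,2) this] eventually_step_right[OF assms(1,2), of d]
    show ?thesis by eventually_elim (simp add: persistent_betti_def)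
  qed
qed

text \<open>The mixed second differences of the persistent Betti numbers over the births up to \<open>s\<close> and the
  deaths after \<open>t\<close> sum to the persistent Betti number of \<open>s\<close> and \<open>t\<close>: telescoping in both directions
  leaves only this corner, as the other three lie where the numbers vanish. So one of the
  differences is positive, and being a natural number it satisfies the definite description of
  \<open>diagram_mult\<close>.\<close>

lemma persistence_bar_exists:
  assumes C: "finite C" "step_on C K"
    and pos: "persistent_betti k K s t > 0"
    and start: "\<And>x y. x < l \<Longrightarrow> persistent_betti k K x y = 0"
    and final: "\<And>x y. T \<le> y \<Longrightarrow> persistent_betti k K x y = 0"
  obtains b d where "b \<le> s" "t < d" "diagram_mult k K b d > 0"
proof -
  define \<beta> where "\<beta> x y = int (persistent_betti k K x y)" for x y
  obtain e where e: "0 < e" "\<And>c c'. c \<in> C \<Longrightarrow> c' \<in> C \<Longrightarrow> c' < c \<Longrightarrow> c' < c - e"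
    using finite_separation[OF C(1)] by blast
  define D where "D b d = (\<beta> b (d - e) - \<beta> b d) - (\<beta> (b - e) (d - e) - \<beta> (b - e) d)" for b d
  \<comment> \<open>\<open>u\<close> and \<open>v\<close> are scales at which the Betti numbers have become zero.\<close>
  define u where "u = min s (l - 1)"
  define v where "v = max t T"
  have stepK: "K x = K y" if "x \<le> y" "C \<inter> {x<..y} = {}" for x y
    using C(2) that unfolding step_on_def by blast
  have rows: "step_on C (\<lambda>y. \<beta> x y - \<beta> x' y)" and cols: "step_on C (\<lambda>x. \<beta> x y)" for x x' y
    unfolding step_on_def \<beta>_def persistent_betti_def
    by (intro allI impI; elim conjE; drule (1) stepK; simp)+
  have "(\<Sum>b\<in>C \<inter> {u<..s}. \<Sum>d\<in>C \<inter> {t<..v}. D b d) =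
      (\<Sum>b\<in>C \<inter> {u<..s}. \<beta> b t - \<beta> (b - e) t)"
  proof (rule sum.cong[OF refl])
    fix b
    have "(\<Sum>d\<in>C \<inter> {t<..v}. D b d) =
        - (\<Sum>d\<in>C \<inter> {t<..v}. (\<beta> b d - \<beta> (b - e) d) - (\<beta> b (d - e) - \<beta> (b - e) (d - e)))"
      unfolding sum_negf[symmetric] by (rule sum.cong) (auto simp: D_def)
    also have "\<dots> = \<beta> b t - \<beta> (b - e) t"
      using sum_of_jumps[OF C(1) rows e, of t v b "b - e"] final[of v]
      by (simp add: v_def \<beta>_def)
    finally show "(\<Sum>d\<in>C \<inter> {t<..v}. D b d) = \<beta> b t - \<beta> (b - e) t" .
  qed
  also have "\<dots> = \<beta> s t - \<beta> u t"
    by (rule sum_of_jumps[OF C(1) cols e]) (auto simp: u_def)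
  also have "\<dots> > 0"
    using pos start[of u t] by (simp add: u_def \<beta>_def)
  finally obtain b where b: "b \<in> C" "b \<le> s" "(\<Sum>d\<in>C \<inter> {t<..v}. D b d) > 0"
    by (meson IntE greaterThanAtMost_iff not_le sum_nonpos)
  then obtain d where d: "d \<in> C" "t < d" "D b d > 0"
    by (meson IntE greaterThanAtMost_iff not_le sum_nonpos)
  have left: "K (c - e') = K (c - e)" if "c \<in> C" "0 < e'" "e' < e" for c e'
    using that e(2)[OF \<open>c \<in> C\<close>] by (intro stepK[symmetric]) force+
  have "diagram_mult k K b d = nat (D b d)"
  proof (rule diagram_mult_eqI)
    show "\<forall>\<^sub>F e in at_right 0. int (nat (D b d)) =
       (int (persistent_betti k K (b + e) (d - e)) - int (persistent_betti k K (b + e) (d + e)))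
     - (int (persistent_betti k K (b - e) (d - e)) - int (persistent_betti k K (b - e) (d + e)))"
      using eventually_step_right[OF C, of b] eventually_step_right[OF C, of d]
        eventually_small_positive[OF e(1)]
    proof eventually_elim
      case (elim e')
      then show ?case
        using d(3) left[OF b(1), of e'] left[OF d(1), of e']
        by (simp add: D_def \<beta>_def persistent_betti_def)
    qed
  qed
  then show thesis using that b(2) d(2,3) by simp
qed

definition distances :: "'a::metric_space set \<Rightarrow> real set" where
  "distances Y = (\<lambda>(x, y). dist x y) ` (Y \<times> Y)"

lemma finite_distances: "finite Y \<Longrightarrow> finite (distances Y)"
  by (simp add: distances_def)

lemma dist_in_distances: "x \<in> Y \<Longrightarrow> y \<in> Y \<Longrightarrow> dist x y \<in> distances Y"
  by (auto simp: distances_def)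

lemma step_on_vietoris_rips: "step_on (distances Y) (vietoris_rips Y)"
  unfolding step_on_def
proof (intro allI impI, elim conjE)
  fix a b :: real
  assume "a \<le> b" and empty: "distances Y \<inter> {a<..b} = {}"
  have "dist x y \<le> a \<longleftrightarrow> dist x y \<le> b" if "x \<in> Y" "y \<in> Y" for x y
  proof -
    have "dist x y \<notin> {a<..b}" using empty dist_in_distances[OF that] by blast
    then show ?thesis using \<open>a \<le> b\<close> by auto
  qed
  then show "vietoris_rips Y a = vietoris_rips Y b"
    unfolding vietoris_rips_def by (intro Collect_cong conj_cong refl ball_cong) auto
qed

lemma diagram1_subset:
  assumes "finite Y"
  shows "diagram1 Y \<subseteq> distances Y \<times> distances Y"
proof clarify
  fix b d assume "(b, d) \<in> diagram1 Y"
  then have "diagram_mult 1 (vietoris_rips Y) b d \<noteq> 0" by (simp add: diagram1_def)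
  then show "b \<in> distances Y \<and> d \<in> distances Y"
    using diagram_mult_noncritical[OF finite_distances[OF assms] step_on_vietoris_rips, of b d 1]
    by metis
qed

lemma finite_diagram1: "finite Y \<Longrightarrow> finite (diagram1 Y)"
  using diagram1_subset by (rule finite_subset) (auto simp: finite_distances)

lemma dominant_functional_ge:
  assumes "finite Y" "(b, d) \<in> diagram1 Y"
  shows "d - b \<le> dominant_functional Y"
proof -
  have "finite ((\<lambda>(b, d). d - b) ` diagram1 Y)" using assms finite_diagram1 by blast
  then show ?thesis
    using assms(2) unfolding dominant_functional_def by (auto intro!: Max_ge)
qed

lemma dominant_functional_le_diameter:
  assumes "finite Y" "0 \<le> D" "\<And>x y. x \<in> Y \<Longrightarrow> y \<in> Y \<Longrightarrow> dist x y \<le> D"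
  shows "dominant_functional Y \<le> D"
proof -
  have "d - b \<le> D" if "(b, d) \<in> diagram1 Y" for b d
  proof -
    have "b \<in> distances Y" "d \<in> distances Y"
      using diagram1_subset[OF assms(1)] that by blast+
    then have "0 \<le> b" "d \<le> D" using assms(3) by (auto simp: distances_def)
    then show ?thesis by simp
  qed
  then show ?thesis
    using assms(2) finite_diagram1[OF assms(1)]
    unfolding dominant_functional_def by (auto intro!: Max.boundedI)
qed

lemma cycles_empty_subset: "cycles k {} \<subseteq> boundaries k K"
proof
  fix c :: "'a set \<Rightarrow> bit" assume "c \<in> cycles k {}"
  then have "c = boundary 0" unfolding boundary_zero by (intro ext) (auto simp: cycles_def chains_def)
  then show "c \<in> boundaries k K"
    unfolding boundaries_def using zero_in_chains by blast
qed

text \<open>The Betti numbers of the filtration vanish at negative scales, where the complex is empty, and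
  beyond the diameter, where it is a cone over any of its vertices.\<close>

lemma dominant_functional_gt:
  fixes Y :: "'a::metric_space set"
  assumes "finite Y" "s \<le> t" and pos: "persistent_betti 1 (vietoris_rips Y) s t > 0"
  shows "dominant_functional Y > t - s"
proof -
    have fin: "finite (distances Y)" using assms(1) by (rule finite_distances)
  define T where "T = Max (distances Y)"
  have T: "c \<le> T" if "c \<in> distances Y" for c
    unfolding T_def using fin that by (rule Max_ge)
  have start: "persistent_betti 1 (vietoris_rips Y) x y = 0" if "x < 0" for x y
  proof (rule persistent_betti_eq_0)
    have "False" if "s \<in> vietoris_rips Y x" for s
    proof -
      obtain z where "z \<in> s" "dist z z \<le> x" using \<open>s \<in> vietoris_rips Y x\<close>
        unfolding vietoris_rips_def by blast
      then show False using \<open>x < 0\<close> by simp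
    qed
    then have "vietoris_rips Y x = {}" by blast
    then show "cycles 1 (vietoris_rips Y x) \<subseteq> boundaries 1 (vietoris_rips Y y)"
      by (simp only: cycles_empty_subset)
  qed
  have final: "persistent_betti 1 (vietoris_rips Y) x y = 0" if "T \<le> y" for x y
  proof (cases "Y = {}")
    case True
    then have "vietoris_rips Y x = {}" by (auto simp: vietoris_rips_def)
    then show ?thesis
      by (intro persistent_betti_eq_0) (simp only: cycles_empty_subset)
  next
    case False
    then obtain p where p: "p \<in> Y" by blast
    have full: "s \<in> vietoris_rips Y y" if "s \<noteq> {}" "s \<subseteq> Y" for s
    proof -
      have "dist u v \<le> y" if "u \<in> Y" "v \<in> Y" for u v
        using T[OF dist_in_distances[OF that]] \<open>T \<le> y\<close> by simp
      then show ?thesis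
        using that assms(1) finite_subset[of s Y] by (auto simp: vietoris_rips_def)
    qed
    have "vietoris_rips Y x \<subseteq> vietoris_rips Y y"
    proof
      fix s assume "s \<in> vietoris_rips Y x"
      then have "s \<noteq> {}" "s \<subseteq> Y" by (auto simp: vietoris_rips_def)
      then show "s \<in> vietoris_rips Y y" by (rule full)
    qed
    then have "cycles 1 (vietoris_rips Y x) \<subseteq> cycles 1 (vietoris_rips Y y)"
      unfolding cycles_def chains_def by blast
    also have "\<dots> \<subseteq> boundaries 1 (vietoris_rips Y y)"
    proof (rule cycle_is_boundary_of_cone)
      show "finite (vietoris_rips Y y)" using assms(1)
        by (rule finite_subset[of _ "Pow Y", rotated, OF finite_Pow_iff[THEN iffD2]]) (auto simp: vietoris_rips_def)
      show "insert p s \<in> vietoris_rips Y y" if "s \<in> vietoris_rips Y y" for s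
        using that p by (intro full) (auto simp: vietoris_rips_def)
    qed
    finally show ?thesis by (rule persistent_betti_eq_0)
  qed
  obtain b d where "b \<le> s" "t < d" "diagram_mult 1 (vietoris_rips Y) b d > 0"
    using persistence_bar_exists[OF fin step_on_vietoris_rips pos start final] by metis
  moreover from this have "(b, d) \<in> diagram1 Y" using assms(2) by (simp add: diagram1_def)
  ultimately show ?thesis using dominant_functional_ge[OF assms(1)] by fastforce
qed


section \<open>Angle increments along edges\<close>

text \<open>Two logarithms of the same function differ by a continuous function with values in the discrete
  set of multiples of \<open>2 * pi * \<i>\<close>.\<close>

lemma continuous_log_increment_unique:
  fixes L L' :: "'a::topological_space \<Rightarrow> complex"
  assumes "connected S" "continuous_on S L" "continuous_on S L'"
    and "\<And>x. x \<in> S \<Longrightarrow> exp (L x) = exp (L' x)" and "a \<in> S" "b \<in> S"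
  shows "L b - L a = L' b - L' a"
proof -
  have "(\<lambda>x. L x - L' x) constant_on S"
  proof (rule continuous_discrete_range_constant[OF assms(1)])
    show "continuous_on S (\<lambda>x. L x - L' x)" using assms(2,3) by (rule continuous_on_diff)
    fix x assume "x \<in> S"
    have "2 * pi \<le> norm ((L y - L' y) - (L x - L' x))"
      if y: "y \<in> S" "L y - L' y \<noteq> L x - L' x" for y
    proof -
      obtain m n :: int where m: "L x = L' x + (of_int (2 * m) * pi) * \<i>"
        and n: "L y = L' y + (of_int (2 * n) * pi) * \<i>"
        using assms(4) \<open>x \<in> S\<close> y(1) exp_eq by meson
      have eq: "(L y - L' y) - (L x - L' x) = complex_of_real (2 * pi * of_int (n - m)) * \<i>"
        using m n by (simp add: algebra_simps)
      then have "n - m \<noteq> 0" using y(2) by auto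
      then have "1 \<le> \<bar>real_of_int (n - m)\<bar>" by linarith
      then have "2 * pi * 1 \<le> 2 * pi * \<bar>real_of_int (n - m)\<bar>"
        by (intro mult_left_mono) auto
      then show ?thesis
        unfolding eq norm_mult norm_of_real by (simp add: abs_mult)
    qed
    then show "\<exists>e>0. \<forall>y. y \<in> S \<and> L y - L' y \<noteq> L x - L' x \<longrightarrow> e \<le> norm ((L y - L' y) - (L x - L' x))"
      by (intro exI[of _ "2 * pi"]) auto
  qed
  then obtain k where "\<And>x. x \<in> S \<Longrightarrow> L x - L' x = k" unfolding constant_on_def by blast
  from this[OF assms(5)] this[OF assms(6)] show ?thesis by (simp add: algebra_simps)
qed

text \<open>The change of a continuous logarithm of \<open>H\<close> along the segment from \<open>a\<close> to \<open>b\<close>. By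
  \<open>continuous_log_increment_unique\<close> it does not depend on the logarithm chosen.\<close>

definition log_increment :: "('a::real_normed_vector \<Rightarrow> complex) \<Rightarrow> 'a \<Rightarrow> 'a \<Rightarrow> complex" where
  "log_increment H a b = (SOME w. \<exists>L. continuous_on (closed_segment a b) L \<and>
     (\<forall>x\<in>closed_segment a b. H x = exp (L x)) \<and> w = L b - L a)"

text \<open>The increment can be read off any continuous logarithm on a convex set containing both ends.
  This is what makes increments comparable between different edges.\<close>

lemma log_increment_eq:
  assumes "convex S" "continuous_on S L" "\<And>x. x \<in> S \<Longrightarrow> H x = exp (L x)" "a \<in> S" "b \<in> S"
  shows "log_increment H a b = L b - L a"
  unfolding log_increment_def
proof (rule some_equality)
  have sub: "closed_segment a b \<subseteq> S"
    using assms(1,4,5) by (simp add: closed_segment_subset)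
  show "\<exists>L'. continuous_on (closed_segment a b) L' \<and>
     (\<forall>x\<in>closed_segment a b. H x = exp (L' x)) \<and> L b - L a = L' b - L' a"
    using continuous_on_subset[OF assms(2) sub] assms(3) sub by blast
  fix w assume "\<exists>L'. continuous_on (closed_segment a b) L' \<and>
     (\<forall>x\<in>closed_segment a b. H x = exp (L' x)) \<and> w = L' b - L' a"
  then obtain L' where L': "continuous_on (closed_segment a b) L'"
    "\<And>x. x \<in> closed_segment a b \<Longrightarrow> H x = exp (L' x)" "w = L' b - L' a" by blast
  have "L' b - L' a = L b - L a"
  proof (rule continuous_log_increment_unique)
    show "connected (closed_segment a b)" by (rule connected_segment)
    show "continuous_on (closed_segment a b) L" using assms(2) sub by (rule continuous_on_subset)
    show "exp (L' x) = exp (L x)" if "x \<in> closed_segment a b" for x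
      using L'(2)[OF that] assms(3) sub that by force
  qed (use L' in auto)
  then show "w = L b - L a" using L'(3) by simp
qed

lemma continuous_log_on_convex:
  fixes H :: "'a::real_normed_vector \<Rightarrow> complex"
  assumes "continuous_on U H" "\<And>x. x \<in> U \<Longrightarrow> H x \<noteq> 0" "convex S" "S \<subseteq> U"
  obtains L where "continuous_on S L" "\<And>x. x \<in> S \<Longrightarrow> H x = exp (L x)"
  using continuous_logarithm_on_contractible[of S H] assms
  by (metis continuous_on_subset convex_imp_contractible subsetD)

lemma log_increment_triangle:
  fixes H :: "'a::real_normed_vector \<Rightarrow> complex"
  assumes "continuous_on U H" "\<And>x. x \<in> U \<Longrightarrow> H x \<noteq> 0"
    and "convex S" "S \<subseteq> U" "a \<in> S" "b \<in> S" "c \<in> S"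
  shows "log_increment H a b + log_increment H b c = log_increment H a c"
proof -
  obtain L where L: "continuous_on S L" "\<And>x. x \<in> S \<Longrightarrow> H x = exp (L x)"
    using continuous_log_on_convex[OF assms(1-4)] by blast
  show ?thesis
    using log_increment_eq[OF assms(3) L] assms(5-7) by simp
qed

text \<open>Within a convex part of the domain the segment may be replaced by a path.\<close>

lemma log_increment_along_path:
  fixes H :: "'a::real_normed_vector \<Rightarrow> complex" and \<gamma> :: "real \<Rightarrow> 'a"
  assumes "continuous_on U H" "\<And>x. x \<in> U \<Longrightarrow> H x \<noteq> 0"
    and "convex S" "S \<subseteq> U" and "s \<le> t" "continuous_on {s..t} \<gamma>" "\<gamma> ` {s..t} \<subseteq> S"
    and "continuous_on {s..t} \<theta>" "\<And>u. u \<in> {s..t} \<Longrightarrow> H (\<gamma> u) = exp (\<theta> u)"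
  shows "log_increment H (\<gamma> s) (\<gamma> t) = \<theta> t - \<theta> s"
proof -
  obtain L where L: "continuous_on S L" "\<And>x. x \<in> S \<Longrightarrow> H x = exp (L x)"
    using continuous_log_on_convex[OF assms(1-4)] by blast
  have "log_increment H (\<gamma> s) (\<gamma> t) = L (\<gamma> t) - L (\<gamma> s)"
    by (rule log_increment_eq[OF assms(3) L]) (use assms(5,7) in auto)
  also have "\<dots> = \<theta> t - \<theta> s"
  proof (rule continuous_log_increment_unique[of "{s..t}" "\<lambda>u. L (\<gamma> u)" \<theta> s t])
    show "continuous_on {s..t} (\<lambda>u. L (\<gamma> u))"
      by (rule continuous_on_compose2[OF L(1) assms(6,7)])
    show "exp (L (\<gamma> u)) = exp (\<theta> u)" if "u \<in> {s..t}" for u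
      using that L(2)[of "\<gamma> u"] assms(7,9) by force
  qed (use assms(5,8) in auto)
  finally show ?thesis .
qed

text \<open>The integer by which the increment along an edge misses the difference of the principal
  logarithms at its ends. Increments are additive on triangles and the differences of the principal
  logarithms always are, so the integers form a cocycle; around a closed edge path the principal
  logarithms cancel and the integers add up to the winding number.\<close>

definition winding_correction :: "('a::real_normed_vector \<Rightarrow> complex) \<Rightarrow> 'a \<Rightarrow> 'a \<Rightarrow> int" where
  "winding_correction H a b =
     (THE n. log_increment H a b = Ln (H b) - Ln (H a) + 2 * of_int n * of_real pi * \<i>)"

lemma winding_correction:
  fixes H :: "'a::real_normed_vector \<Rightarrow> complex"
  assumes "continuous_on U H" "\<And>x. x \<in> U \<Longrightarrow> H x \<noteq> 0" and "closed_segment a b \<subseteq> U"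
  shows "log_increment H a b =
    Ln (H b) - Ln (H a) + 2 * of_int (winding_correction H a b) * of_real pi * \<i>"
proof -
  obtain L where L: "continuous_on (closed_segment a b) L"
    "\<And>x. x \<in> closed_segment a b \<Longrightarrow> H x = exp (L x)"
    using continuous_log_on_convex[OF assms(1,2) convex_closed_segment assms(3)] by blast
  have inc: "log_increment H a b = L b - L a"
    by (rule log_increment_eq[OF convex_closed_segment L]) auto
  have "a \<in> U" "b \<in> U" using assms(3) by auto
  then have "H a \<noteq> 0" "H b \<noteq> 0" using assms(2) by auto
  then have "exp (L b - L a) = exp (Ln (H b) - Ln (H a))"
    using L(2)[of a] L(2)[of b] by (simp add: exp_diff)
  then obtain n :: int where "L b - L a = (Ln (H b) - Ln (H a)) + (of_int (2 * n) * pi) * \<i>"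
    using exp_eq by blast
  then have n: "log_increment H a b = Ln (H b) - Ln (H a) + 2 * of_int n * of_real pi * \<i>"
    unfolding inc by simp
  show ?thesis
    unfolding winding_correction_def
    by (rule theI[of _ n]) (use n in auto)
qed

text \<open>One of the three barycentric coordinates of \<open>x\<close> is at least \<open>1/3\<close>; moving the remaining mass, at
  most \<open>2/3\<close>, to that vertex displaces \<open>x\<close> by at most \<open>2/3 * t\<close>.\<close>

lemma triangle_point_near_vertex:
  fixes a b c :: "'a::real_normed_vector"
  assumes "x \<in> convex hull {a, b, c}" "dist a b \<le> t" "dist b c \<le> t" "dist a c \<le> t"
  shows "\<exists>p\<in>{a, b, c}. dist x p \<le> 2/3 * t"
proof -
  have vertex: "dist (u *\<^sub>R a + v *\<^sub>R b + w *\<^sub>R c) a \<le> 2/3 * t"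
    if "0 \<le> v" "0 \<le> w" "u + v + w = 1" "1/3 \<le> u" "dist a b \<le> t" "dist a c \<le> t"
    for u v w and a b c :: 'a
  proof -
    have "u *\<^sub>R a + v *\<^sub>R b + w *\<^sub>R c - a = v *\<^sub>R (b - a) + w *\<^sub>R (c - a) + (u + v + w - 1) *\<^sub>R a"
      by (simp add: algebra_simps)
    then have "dist (u *\<^sub>R a + v *\<^sub>R b + w *\<^sub>R c) a = norm (v *\<^sub>R (b - a) + w *\<^sub>R (c - a))"
      using that(3) by (simp add: dist_norm)
    also have "\<dots> \<le> v * dist a b + w * dist a c"
      using that by (intro norm_triangle_le) (simp add: dist_norm norm_minus_commute)
    also have "\<dots> \<le> v * t + w * t"
      using that by (intro add_mono mult_left_mono) auto
    also have "\<dots> = (v + w) * t" by (simp add: distrib_right)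
    also have "\<dots> \<le> 2/3 * t"
      using that(3,4) order_trans[OF zero_le_dist that(5)] by (intro mult_right_mono) auto
    finally show ?thesis .
  qed
  obtain u v w where x: "x = u *\<^sub>R a + v *\<^sub>R b + w *\<^sub>R c"
    and uvw: "0 \<le> u" "0 \<le> v" "0 \<le> w" "u + v + w = 1"
    using assms(1) unfolding convex_hull_3 by blast
  consider "1/3 \<le> u" | "1/3 \<le> v" | "1/3 \<le> w" using uvw by linarith
  then show ?thesis
  proof cases
    case 1
    then show ?thesis using vertex[of v w u a b c] assms uvw x by simp
  next
    case 2
    then show ?thesis using vertex[of u w v b a c] assms uvw x
      by (simp add: dist_commute add.commute add.left_commute)
  next
    case 3
    then show ?thesis using vertex[of u v w c a b] assms uvw x
      by (simp add: dist_commute add.commute add.left_commute)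
  qed
qed


section \<open>Coordinates on a tube about a simple closed curve\<close>

text \<open>Nearest points are unique within the reach, and the graph of the nearest point map is closed,
  being cut out by weak inequalities between continuous functions; with values in the compact set
  \<open>M\<close> the map is therefore continuous.\<close>

lemma nearest_point_map:
  fixes M :: "'a::euclidean_space set"
  assumes "compact M" "ereal r < reach M"
  obtains \<pi> where "continuous_on {x. infdist x M \<le> r} \<pi>"
    "\<And>x. infdist x M \<le> r \<Longrightarrow> \<pi> x \<in> M" "\<And>x. 0 \<le> r \<Longrightarrow> x \<in> M \<Longrightarrow> \<pi> x = x"
proof -
  let ?S = "{x. infdist x M \<le> r}"
  obtain r' where "r < r'"
    and r': "\<And>x. infdist x M < r' \<Longrightarrow> \<exists>!y. y \<in> M \<and> (\<forall>z\<in>M. dist x y \<le> dist x z)"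
    using assms(2) unfolding reach_def less_Sup_iff by auto
  then have uniq: "\<exists>!y. y \<in> M \<and> (\<forall>z\<in>M. dist x y \<le> dist x z)" if "x \<in> ?S" for x
    using that by simp
  define \<pi> where "\<pi> x = (THE y. y \<in> M \<and> (\<forall>z\<in>M. dist x y \<le> dist x z))" for x
  have \<pi>: "\<pi> x \<in> M" "\<And>z. z \<in> M \<Longrightarrow> dist x (\<pi> x) \<le> dist x z" if "x \<in> ?S" for x
    using theI'[OF uniq[OF that]] unfolding \<pi>_def by blast+
  have \<pi>_eq: "\<pi> x = y" if "x \<in> ?S" "y \<in> M" "\<And>z. z \<in> M \<Longrightarrow> dist x y \<le> dist x z" for x y
    using uniq[OF that(1)] \<pi>[OF that(1)] that(2,3) by blast
  have infdist: "infdist x M = dist x (\<pi> x)" if "x \<in> ?S" for x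
  proof (rule antisym)
    show "infdist x M \<le> dist x (\<pi> x)" by (rule infdist_le[OF \<pi>(1)[OF that]])
    have "M \<noteq> {}" using \<pi>(1)[OF that] by blast
    then show "dist x (\<pi> x) \<le> infdist x M"
      unfolding infdist_notempty[OF \<open>M \<noteq> {}\<close>] using \<pi>(2)[OF that] by (intro cINF_greatest) auto
  qed
  have "(\<lambda>x. (x, \<pi> x)) ` ?S = {p. infdist (fst p) M \<le> r} \<inter> (UNIV \<times> M) \<inter>
      {p. dist (fst p) (snd p) \<le> infdist (fst p) M}" (is "_ = ?G")
  proof (intro subset_antisym subsetI)
    fix p assume "p \<in> ?G"
    then have "fst p \<in> ?S" "snd p \<in> M" "dist (fst p) (snd p) \<le> infdist (fst p) M" by auto
    moreover from this have "\<pi> (fst p) = snd p"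
      by (intro \<pi>_eq) (use infdist_le order_trans in blast)+
    ultimately show "p \<in> (\<lambda>x. (x, \<pi> x)) ` ?S"
      by (metis (no_types, lifting) image_eqI prod.collapse)
  next
    fix p assume "p \<in> (\<lambda>x. (x, \<pi> x)) ` ?S"
    then obtain x where x: "x \<in> ?S" "p = (x, \<pi> x)" by blast
    then show "p \<in> ?G" using \<pi>(1)[OF x(1)] eq_refl[OF infdist[OF x(1), symmetric]] by simp
  qed
  moreover have "closed ?G"
    using assms(1)
    by (intro closed_Int closed_Collect_le closed_Times continuous_intros compact_imp_closed closed_UNIV) auto
  ultimately have "continuous_on ?S \<pi>"
    using \<pi>(1) by (intro continuous_from_closed_graph[OF assms(1)]) auto
  then show thesis
  proof (rule that)
    show "\<pi> x = x" if "0 \<le> r" "x \<in> M" for x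
      using that by (intro \<pi>_eq) auto
  qed (use \<pi>(1) in auto)
qed

text \<open>The homeomorphism of a simple closed curve to the unit circle that matches the given
  parametrization. Its graph is the image of the parameter interval under a continuous map,
  hence compact, whence its continuity.\<close>

lemma circle_coordinate:
  fixes \<gamma> :: "real \<Rightarrow> 'a::euclidean_space"
  assumes "continuous_on {0..1} \<gamma>" "inj_on \<gamma> {0..<1}" "\<gamma> 1 = \<gamma> 0"
  obtains g where "continuous_on (\<gamma> ` {0..1}) g"
    "\<And>t. t \<in> {0..1} \<Longrightarrow> g (\<gamma> t) = exp (2 * of_real pi * \<i> * complex_of_real t)"
proof -
  let ?e = "\<lambda>t. exp (2 * of_real pi * \<i> * complex_of_real t)"
  define g where "g x = ?e (SOME t. t \<in> {0..1} \<and> \<gamma> t = x)" for x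
  have e1: "?e 1 = ?e 0" by (simp add: exp_eq_1)
  \<comment> \<open>Parameters are reduced to \<open>{0..<1}\<close>, where \<open>\<gamma>\<close> is injective.\<close>
  define \<rho> :: "real \<Rightarrow> real" where "\<rho> t = (if t = 1 then 0 else t)" for t
  have \<rho>: "\<rho> t \<in> {0..<1}" "\<gamma> (\<rho> t) = \<gamma> t" "?e (\<rho> t) = ?e t" if "t \<in> {0..1}" for t
    using that assms(3) e1 by (auto simp: \<rho>_def)
  have well: "?e s = ?e t" if "s \<in> {0..1}" "t \<in> {0..1}" "\<gamma> s = \<gamma> t" for s t
    using inj_onD[OF assms(2), of "\<rho> s" "\<rho> t"] \<rho>[OF that(1)] \<rho>[OF that(2)] that(3) by metis
  have g: "g (\<gamma> t) = ?e t" if "t \<in> {0..1}" for t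
  proof -
    have "(SOME s. s \<in> {0..1} \<and> \<gamma> s = \<gamma> t) \<in> {0..1} \<and> \<gamma> (SOME s. s \<in> {0..1} \<and> \<gamma> s = \<gamma> t) = \<gamma> t"
      by (rule someI[of _ t]) (use that in simp)
    then show ?thesis unfolding g_def using that by (intro well) auto
  qed
  have "continuous_on (\<gamma> ` {0..1}) g"
  proof (rule continuous_from_closed_graph)
    show "compact (sphere (0::complex) 1)" by simp
    show "g \<in> \<gamma> ` {0..1} \<rightarrow> sphere 0 1" using g by auto
    have "(\<lambda>x. (x, g x)) ` \<gamma> ` {0..1} = (\<lambda>t. (\<gamma> t, ?e t)) ` {0..1}"
      unfolding image_image by (intro image_cong) (use g in auto)
    moreover have "compact ((\<lambda>t. (\<gamma> t, ?e t)) ` {0..1})"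
      using assms(1) by (intro compact_continuous_image continuous_intros compact_Icc)
    ultimately show "closed ((\<lambda>x. (x, g x)) ` \<gamma> ` {0..1})"
      using compact_imp_closed by metis
  qed
  then show thesis using that g by blast
qed


section \<open>Long bars near a simple closed curve\<close>

lemma fine_subdivision:
  fixes \<gamma> :: "real \<Rightarrow> 'a::metric_space"
  assumes "continuous_on {0..1} \<gamma>" "0 < \<epsilon>"
  obtains N :: nat where "0 < N"
    "\<And>i t. i < N \<Longrightarrow> t \<in> {real i / real N..real (Suc i) / real N} \<Longrightarrow> dist (\<gamma> (real i / real N)) (\<gamma> t) < \<epsilon>"
proof -
  have "uniformly_continuous_on {0..1} \<gamma>"
    using assms(1) by (intro compact_uniformly_continuous) auto
  then obtain d where d: "0 < d"
    "\<And>s t. s \<in> {0..1} \<Longrightarrow> t \<in> {0..1} \<Longrightarrow> dist t s < d \<Longrightarrow> dist (\<gamma> t) (\<gamma> s) < \<epsilon>"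
    using assms(2) unfolding uniformly_continuous_on_def by metis
  obtain N :: nat where N: "0 < N" "inverse (real N) < d"
    using d(1) real_arch_inverse[of d] by auto
  show thesis
  proof (rule that[OF N(1)])
    fix i t assume i: "i < N" and t: "t \<in> {real i / real N..real (Suc i) / real N}"
    have hi: "real (Suc i) / real N \<le> 1" using i by auto
    have "t \<le> 1" using t hi order_trans[of t "real (Suc i) / real N" 1] by simp
    moreover have "0 \<le> t" using t order_trans[of 0 "real i / real N" t] by simp
    ultimately have "real i / real N \<in> {0..1}" "t \<in> {0..1}" using i by auto
    moreover have "real (Suc i) / real N - real i / real N = inverse (real N)"
      using N(1) by (simp add: field_simps)
    then have "dist (real i / real N) t < d" using t N(2) by (auto simp: dist_real_def)
    ultimately show "dist (\<gamma> (real i / real N)) (\<gamma> t) < \<epsilon>" using d(2) by blast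
  qed
qed

text \<open>The tube of radius \<open>r\<close> contains the full triangles of the complex at scale \<open>t\<close>, hence the winding
  corrections of \<open>H\<close> are a cocycle there. It also contains the balls of radius \<open>r\<close> about points of
  the curve. One such ball holds two consecutive stops on the curve together with their substitutes
  in \<open>X\<close>, so exchanging the stops for the substitutes does not change the total increment around
  the loop, which along the curve is \<open>2 * pi * \<i>\<close>. The margin \<open>\<nu>\<close> is room for the distance between
  consecutive stops.\<close>

lemma persistent_loop_near_closed_curve:
  fixes \<gamma> :: "real \<Rightarrow> 'a::euclidean_space" and X :: "'a set"
  assumes \<gamma>: "continuous_on {0..1} \<gamma>" "inj_on \<gamma> {0..<1}" "\<gamma> 1 = \<gamma> 0" and M: "M = \<gamma> ` {0..1}"
    and X: "finite X" "\<And>x. x \<in> X \<Longrightarrow> infdist x M \<le> \<kappa>" "\<And>m. m \<in> M \<Longrightarrow> \<exists>x\<in>X. dist m x \<le> \<kappa>"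
    and r: "ereal r < reach M"
    and \<nu>: "0 < \<nu>" "\<kappa> + \<nu> < r" and t: "2 * \<kappa> + \<nu> \<le> t" "\<kappa> + 2/3 * t < r"
  shows "persistent_betti 1 (vietoris_rips X) (2 * \<kappa> + \<nu>) t > 0"
proof -
  have "compact M" unfolding M using \<gamma>(1) by (intro compact_continuous_image compact_Icc)
  have "\<gamma> 0 \<in> M" unfolding M by simp
  then obtain x0 where "dist (\<gamma> 0) x0 \<le> \<kappa>" using X(3) by blast
  then have "0 \<le> \<kappa>" using order_trans[OF zero_le_dist] by blast
  then have "0 < r" using \<nu> by simp
  define U where "U = {x. infdist x M \<le> r}"
  obtain \<pi> where \<pi>: "continuous_on U \<pi>" "\<And>x. x \<in> U \<Longrightarrow> \<pi> x \<in> M" "\<And>x. x \<in> M \<Longrightarrow> \<pi> x = x"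
    using nearest_point_map[OF \<open>compact M\<close> r] \<open>0 < r\<close> unfolding U_def by auto
  obtain g where g: "continuous_on M g"
    "\<And>t. t \<in> {0..1} \<Longrightarrow> g (\<gamma> t) = exp (2 * of_real pi * \<i> * complex_of_real t)"
    using circle_coordinate[OF \<gamma>] unfolding M by blast
  define H where "H x = g (\<pi> x)" for x
  have H: "continuous_on U H"
    unfolding H_def by (rule continuous_on_compose2[OF g(1) \<pi>(1)]) (use \<pi>(2) in blast)
  have H0: "H x \<noteq> 0" if "x \<in> U" for x
  proof -
    have "\<pi> x \<in> M" using that by (rule \<pi>(2))
    then obtain s where "s \<in> {0..1}" "\<pi> x = \<gamma> s" unfolding M by blast
    then show ?thesis using g(2) by (simp add: H_def)
  qed
  have H\<gamma>: "H (\<gamma> s) = exp (2 * of_real pi * \<i> * complex_of_real s)" if "s \<in> {0..1}" for s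
    using g(2)[OF that] \<pi>(3)[of "\<gamma> s"] that M by (simp add: H_def)
  let ?n = "winding_correction H" and ?inc = "log_increment H"
  have triangle: "?inc a b + ?inc b c = ?inc a c"
    if "convex S" "S \<subseteq> U" "a \<in> S" "b \<in> S" "c \<in> S" for S a b c
    using log_increment_triangle[OF H H0 that] .
  have correction: "?inc a b = Ln (H b) - Ln (H a) + 2 * of_int (?n a b) * of_real pi * \<i>"
    if "convex S" "S \<subseteq> U" "a \<in> S" "b \<in> S" for S a b
    using winding_correction[OF H H0, of a b] closed_segment_subset[OF that(3,4,1)] that(2) by blast

  have cocycle: "?n u v + ?n v w = ?n u w"
    if "u \<in> X" "v \<in> X" "w \<in> X" "dist u v \<le> t" "dist v w \<le> t" "dist u w \<le> t" for u v w
  proof -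
    note uvw = that
    let ?S = "convex hull {u, v, w}"
    have S: "?S \<subseteq> U"
    proof
      fix x assume "x \<in> ?S"
      then obtain p where "p \<in> {u, v, w}" and p: "dist x p \<le> 2/3 * t"
        using triangle_point_near_vertex uvw(4-6) by blast
      then have "infdist p M \<le> \<kappa>" using X(2) uvw(1-3) by blast
      then have "infdist x M \<le> r" using infdist_triangle[of x M p] p t(2) by simp
      then show "x \<in> U" by (simp add: U_def)
    qed
    have mem: "u \<in> ?S" "v \<in> ?S" "w \<in> ?S" by (auto intro: hull_inc)
    have "2 * of_int (?n u v + ?n v w) * of_real pi * \<i> = 2 * of_int (?n u w) * of_real pi * \<i>"
      using triangle[OF convex_convex_hull S mem] correction[OF convex_convex_hull S mem(1,2)]
        correction[OF convex_convex_hull S mem(2,3)] correction[OF convex_convex_hull S mem(1,3)]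
      by (simp add: algebra_simps)
    then have "(of_int (?n u v + ?n v w) :: complex) = of_int (?n u w)"
      by (simp del: of_int_add)
    then show ?thesis by (simp only: of_int_eq_iff)
  qed

  obtain N :: nat where N: "0 < N"
    and fine: "\<And>i t. i < N \<Longrightarrow> t \<in> {real i / real N..real (Suc i) / real N} \<Longrightarrow>
      dist (\<gamma> (real i / real N)) (\<gamma> t) < \<nu>"
    using fine_subdivision[OF \<gamma>(1) \<nu>(1)] by blast
  define m where "m i = \<gamma> (real i / real N)" for i
  obtain f where f: "\<And>m. m \<in> M \<Longrightarrow> f m \<in> X \<and> dist m (f m) \<le> \<kappa>" using X(3) by metis
  define x where "x i = f (m i)" for i
  have m: "m i \<in> M" if "i \<le> N" for i
    unfolding M m_def using that N by (intro imageI) simp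
  have x: "x i \<in> X" "dist (m i) (x i) \<le> \<kappa>" if "i \<le> N" for i
    unfolding x_def using f m[OF that] by blast+
  have mm: "dist (m i) (m (Suc i)) < \<nu>" if "i < N" for i
    unfolding m_def using fine[OF that, of "real (Suc i) / real N"] by (simp add: divide_right_mono)
  have closed: "m N = m 0" "x N = x 0" using N \<gamma>(3) by (simp_all add: m_def x_def)
  \<comment> \<open>The increments from the points of the cloud to the stops on the curve telescope.\<close>
  define c where "c i = ?inc (x i) (m i)" for i
  have step: "?inc (x i) (x (Suc i)) = 2 * of_real pi * \<i> / of_nat N - (c (Suc i) - c i)"
    and stepn: "?inc (x i) (x (Suc i)) =
      Ln (H (x (Suc i))) - Ln (H (x i)) + 2 * of_int (?n (x i) (x (Suc i))) * of_real pi * \<i>"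
    if i: "i < N" for i
  proof -
    let ?B = "ball (m i) r"
    have B: "?B \<subseteq> U"
    proof
      fix y assume "y \<in> ?B"
      then have "infdist y M \<le> r"
        using infdist_le[OF m[of i], of y] i by (simp add: dist_commute)
      then show "y \<in> U" by (simp add: U_def)
    qed
    have mem: "m i \<in> ?B" "m (Suc i) \<in> ?B" "x i \<in> ?B" "x (Suc i) \<in> ?B"
      using \<open>0 < r\<close> mm[OF i] x(2)[of i] x(2)[of "Suc i"] i \<nu> \<open>0 \<le> \<kappa>\<close>
        dist_triangle[of "m i" "x (Suc i)" "m (Suc i)"] by auto
    note tri = triangle[OF convex_ball B]
    have "?inc (m i) (m (Suc i)) = 2 * of_real pi * \<i> * complex_of_real (real (Suc i) / real N)
        - 2 * of_real pi * \<i> * complex_of_real (real i / real N)"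
      unfolding m_def
    proof (rule log_increment_along_path[OF H H0 convex_ball B])
      have "real (Suc i) / real N \<le> 1" using i by auto
      then have sub: "{real i / real N..real (Suc i) / real N} \<subseteq> {0..1}" by auto
      show "real i / real N \<le> real (Suc i) / real N" by (simp add: divide_right_mono)
      show "continuous_on {real i / real N..real (Suc i) / real N} \<gamma>"
        using \<gamma>(1) sub by (rule continuous_on_subset)
      show "\<gamma> ` {real i / real N..real (Suc i) / real N} \<subseteq> ?B"
        using fine[OF i] \<nu> \<open>0 \<le> \<kappa>\<close> unfolding m_def by fastforce
      show "continuous_on {real i / real N..real (Suc i) / real N}
          (\<lambda>t. 2 * of_real pi * \<i> * complex_of_real t)"
        by (intro continuous_intros)
      show "H (\<gamma> u) = exp (2 * of_real pi * \<i> * complex_of_real u)"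
        if "u \<in> {real i / real N..real (Suc i) / real N}" for u
        by (rule H\<gamma>) (use that sub in blast)
    qed
    also have "\<dots> = 2 * of_real pi * \<i> / of_nat N"
      using N by (simp add: field_simps)
    finally have mid: "?inc (m i) (m (Suc i)) = 2 * of_real pi * \<i> / of_nat N" .
    have "?inc (x (Suc i)) (x (Suc i)) + ?inc (x (Suc i)) (x (Suc i)) = ?inc (x (Suc i)) (x (Suc i))"
      by (rule tri[OF mem(4) mem(4) mem(4)])
    then have reverse: "?inc (m (Suc i)) (x (Suc i)) = - c (Suc i)"
      using tri[OF mem(4) mem(2) mem(4)] unfolding c_def by (simp add: eq_neg_iff_add_eq_0 add.commute)
    have "?inc (x i) (x (Suc i)) = c i + (?inc (m i) (m (Suc i)) + ?inc (m (Suc i)) (x (Suc i)))"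
      using tri[OF mem(3) mem(1) mem(4)] tri[OF mem(1) mem(2) mem(4)] by (simp add: c_def)
    then show "?inc (x i) (x (Suc i)) = 2 * of_real pi * \<i> / of_nat N - (c (Suc i) - c i)"
      unfolding mid reverse by simp
    show "?inc (x i) (x (Suc i)) =
      Ln (H (x (Suc i))) - Ln (H (x i)) + 2 * of_int (?n (x i) (x (Suc i))) * of_real pi * \<i>"
      by (rule correction[OF convex_ball B mem(3,4)])
  qed
  have "(\<Sum>i<N. ?inc (x i) (x (Suc i))) = (\<Sum>i<N. 2 * of_real pi * \<i> / of_nat N - (c (Suc i) - c i))"
    by (rule sum.cong[OF refl]) (simp add: step)
  also have "\<dots> = 2 * of_real pi * \<i>"
    using N sum_lessThan_telescope[of c N] closed by (simp add: sum_subtractf c_def)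
  finally have total: "(\<Sum>i<N. ?inc (x i) (x (Suc i))) = 2 * of_real pi * \<i>" .
  have "(\<Sum>i<N. ?inc (x i) (x (Suc i))) =
      (\<Sum>i<N. (Ln (H (x (Suc i))) - Ln (H (x i))) + of_int (?n (x i) (x (Suc i))) * (2 * of_real pi * \<i>))"
    by (rule sum.cong[OF refl]) (simp add: stepn)
  also have "\<dots> = of_int (\<Sum>i<N. ?n (x i) (x (Suc i))) * (2 * of_real pi * \<i>)"
    using sum_lessThan_telescope[of "\<lambda>i. Ln (H (x i))" N] closed
    by (simp add: sum.distrib sum_distrib_right)
  finally have "of_int (\<Sum>i<N. ?n (x i) (x (Suc i))) * (2 * of_real pi * \<i>) = 2 * of_real pi * \<i>"
    using total by simp
  then have "(of_int (\<Sum>i<N. ?n (x i) (x (Suc i))) :: complex) = of_int 1"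
    by (simp del: of_int_sum)
  then have "(\<Sum>i<N. ?n (x i) (x (Suc i))) = 1" by (simp only: of_int_eq_iff)
  then have odd: "odd (\<Sum>i<N. ?n (x i) (x (Suc i)))" by simp
  show ?thesis
  proof (rule persistent_betti_loop[OF X(1) t(1) _ _ closed(2) cocycle odd])
    show "dist (x i) (x (Suc i)) \<le> 2 * \<kappa> + \<nu>" if "i < N" for i
      using x(2)[of i] x(2)[of "Suc i"] mm[OF that] that
        dist_triangle[of "x i" "x (Suc i)" "m i"] dist_triangle[of "m i" "x (Suc i)" "m (Suc i)"]
      by (simp add: dist_commute)
  qed (use x in auto)
qed

text \<open>The surplus in \<open>\<eta> + 4 * \<kappa> < 2 * sqrt (3/10) * r\<close> is split in three: one third is the step
  length \<open>\<nu>\<close>, and the bar from \<open>2 * \<kappa> + \<nu>\<close> to beyond \<open>2 * \<kappa> + \<nu> + \<eta>\<close> fits with room to spare.\<close>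

lemma dominant_functional_near_closed_curve:
  fixes \<gamma> :: "real \<Rightarrow> 'a::euclidean_space" and X :: "'a set"
  assumes "continuous_on {0..1} \<gamma>" "inj_on \<gamma> {0..<1}" "\<gamma> 1 = \<gamma> 0" and "M = \<gamma> ` {0..1}"
    and X: "finite X" "\<And>x. x \<in> X \<Longrightarrow> infdist x M \<le> \<kappa>" "\<And>m. m \<in> M \<Longrightarrow> \<exists>x\<in>X. dist m x \<le> \<kappa>"
    and "ereal r < reach M" and "0 \<le> \<kappa>" "0 \<le> \<eta>" and gap: "\<eta> + 4 * \<kappa> < 2 * sqrt (3/10) * r"
  shows "dominant_functional X > \<eta>"
proof -
  \<comment> \<open>\<open>2 * sqrt (3/10) \<le> 11/10\<close>, and \<open>2/3 * (11/10) < 1\<close> is what keeps triangles in the tube.\<close>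
  have "sqrt (3/10) \<le> sqrt ((11/20)\<^sup>2)" by (intro real_sqrt_le_mono) (simp add: power2_eq_square)
  then have root: "sqrt (3/10) \<le> 11/20" by simp
  have "0 < sqrt (3/10) * r" using gap assms(9,10) by simp
  then have "0 < r" by (simp add: zero_less_mult_iff)
  then have bound: "2 * sqrt (3/10) * r \<le> 11/10 * r"
    using root by (intro mult_right_mono) auto
  define \<nu> where "\<nu> = (2 * sqrt (3/10) * r - (\<eta> + 4 * \<kappa>)) / 3"
  define t where "t = 2 * \<kappa> + \<nu> + \<eta>"
  have \<nu>: "0 < \<nu>" "\<eta> + 4 * \<kappa> + 3 * \<nu> \<le> 11/10 * r"
  proof -
    show "0 < \<nu>" using gap by (simp add: \<nu>_def)
    have "3 * \<nu> = 2 * sqrt (3/10) * r - (\<eta> + 4 * \<kappa>)" by (simp add: \<nu>_def)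
    then show "\<eta> + 4 * \<kappa> + 3 * \<nu> \<le> 11/10 * r" using bound by linarith
  qed
  have st: "2 * \<kappa> + \<nu> \<le> t" using assms(10) by (simp add: t_def)
  have near: "\<kappa> + \<nu> < r" using \<nu> \<open>0 < r\<close> assms(9,10) by simp
  have "3 * \<kappa> + 2 * t < 3 * r" using \<nu> \<open>0 < r\<close> assms(9,10) by (simp add: t_def)
  then have far: "\<kappa> + 2/3 * t < r" by simp
  have "persistent_betti 1 (vietoris_rips X) (2 * \<kappa> + \<nu>) t > 0"
    by (rule persistent_loop_near_closed_curve) (fact assms \<nu>(1) near st far)+
  from dominant_functional_gt[OF X(1) st this] show ?thesis by (simp add: t_def)
qed


section \<open>The attractors and their samples\<close>

lemma hausdorff_dist_commute: "hausdorff_dist A B = hausdorff_dist B A"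
  by (simp add: hausdorff_dist_def max.commute)

lemma infdist_le_hausdorff_dist:
  assumes "bounded A" "a \<in> A"
  shows "infdist a B \<le> hausdorff_dist A B"
proof -
  have "bdd_above ((\<lambda>a. infdist a B) ` A)"
  proof (cases "B = {}")
    case True
    then show ?thesis by (auto simp: infdist_def)
  next
    case False
    then obtain b where "b \<in> B" by blast
    obtain e where "\<And>y. y \<in> A \<Longrightarrow> dist b y \<le> e"
      using assms(1) unfolding bounded_any_center[of A b] by blast
    then have "infdist y B \<le> e" if "y \<in> A" for y
      using infdist_le[OF \<open>b \<in> B\<close>, of y] that by (fastforce simp: dist_commute)
    then show ?thesis by (rule bdd_above.I2)
  qed
  then have "infdist a B \<le> (SUP a\<in>A. infdist a B)" using assms(2) by (rule cSUP_upper[rotated])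
  then show ?thesis by (simp add: hausdorff_dist_def)
qed

lemma hausdorff_near_point:
  fixes B :: "'a::heine_borel set"
  assumes "hausdorff_dist A B \<le> q" "bounded A" "a \<in> A" "closed B" "B \<noteq> {}"
  shows "\<exists>b\<in>B. dist a b \<le> q"
proof -
  obtain b where b: "b \<in> B" "\<And>y. y \<in> B \<Longrightarrow> dist a b \<le> dist a y"
    using distance_attains_inf[OF assms(4,5)] by blast
  then have "dist a b \<le> infdist a B"
    unfolding infdist_notempty[OF assms(5)] using assms(5) by (intro cINF_greatest) auto
  then show ?thesis
    using b(1) infdist_le_hausdorff_dist[OF assms(2,3), of B] assms(1) by force
qed

lemma periodic_orbit_parametrization:
  fixes F :: "'a::real_normed_vector \<Rightarrow> 'a"
  assumes "periodic_orbit F C"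
  obtains \<gamma> :: "real \<Rightarrow> 'a" where "continuous_on {0..1} \<gamma>" "inj_on \<gamma> {0..<1}" "\<gamma> 1 = \<gamma> 0" "C = \<gamma> ` {0..1}"
proof -
  obtain x T where x: "T > 0" "solution_on UNIV F x" "\<And>t. x (t + T) = x t"
    "inj_on x {0..<T}" "C = x ` {0..<T}"
    using assms unfolding periodic_orbit_def by blast
  have "isCont x t" for t
    using x(2) unfolding solution_on_def by (auto intro: has_vector_derivative_continuous)
  then have cont: "continuous_on UNIV x" by (simp add: continuous_on_eq_continuous_at)
  define \<gamma> where "\<gamma> t = x (T * t)" for t
  have closed: "\<gamma> 1 = \<gamma> 0" using x(3)[of 0] by (simp add: \<gamma>_def)
  have range: "(\<lambda>t. T * t) ` {0..<1} = {0..<T}"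
  proof (intro subset_antisym subsetI)
    fix u assume "u \<in> {0..<T}"
    then have "u = T * (u / T)" "u / T \<in> {0..<1}" using x(1) by (auto simp: field_simps)
    then show "u \<in> (\<lambda>t. T * t) ` {0..<1}" by blast
  qed (use x(1) in auto)
  show thesis
  proof (rule that[of \<gamma>])
    show "continuous_on {0..1} \<gamma>"
      unfolding \<gamma>_def by (intro continuous_on_compose2[OF cont] continuous_intros) auto
    show "inj_on \<gamma> {0..<1}"
    proof (rule inj_onI)
      fix s t assume st: "s \<in> {0..<1}" "t \<in> {0..<1}" "\<gamma> s = \<gamma> t"
      then have "T * s \<in> {0..<T}" "T * t \<in> {0..<T}" using range by blast+
      then have "T * s = T * t" using inj_onD[OF x(4)] st(3) unfolding \<gamma>_def by blast
      then show "s = t" using x(1) by simp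
    qed
    have "{0..1::real} = insert 1 {0..<1}" by auto
    then have "\<gamma> ` {0..1} = \<gamma> ` {0..<1}" using closed by (auto intro: image_eqI[of _ _ 0])
    also have "\<dots> = C" unfolding x(5) range[symmetric] image_image \<gamma>_def ..
    finally show "C = \<gamma> ` {0..1}" ..
  qed (rule closed)
qed

theorem corollary1:
  fixes f :: "real^'n \<Rightarrow> real \<Rightarrow> real^'n"
    and I J :: "real set"
    and \<mu>c \<rho> \<Delta> \<tau> :: real
    and xs :: "real \<Rightarrow> real^'n"
    and \<Gamma> :: "real \<Rightarrow> (real^'n) set"
    and h :: "real^'n \<Rightarrow> real"
    and P X :: "real \<Rightarrow> (real^'m::{finite,linorder}) set"
    and \<delta> q :: "real \<Rightarrow> real"
    and A :: "real \<Rightarrow> (real^'n) set"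
    and \<Phi> :: "real \<Rightarrow> real^'n \<Rightarrow> real^'m::{finite,linorder}"
    and M :: "real \<Rightarrow> (real^'m::{finite,linorder}) set"
    and R \<eta>geom :: "real \<Rightarrow> ereal"
    and Bminus Bplus :: ereal
  defines "A \<equiv> \<lambda>\<mu>. if \<mu> < \<mu>c then {xs \<mu>} else \<Gamma> \<mu>"
    and "\<Phi> \<equiv> \<lambda>\<mu>. delay_map \<tau> h (\<lambda>x. f x \<mu>)"
    and "M \<equiv> \<lambda>\<mu>. \<Phi> \<mu> ` A \<mu>"
    and "R \<equiv> \<lambda>\<mu>. reach (M \<mu>)"
    and "\<eta>geom \<equiv> \<lambda>\<mu>. 2 * (ereal (sqrt (3/10)) * R \<mu> - ereal (2 * \<delta> \<mu>))"
    and "Bminus \<equiv> SUP \<mu>\<in>{\<mu>c - \<rho>..\<mu>c - \<Delta>}. ereal (4 * q \<mu>)"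
    and "Bplus \<equiv> INF \<mu>\<in>{\<mu>c + \<Delta>..\<mu>c + \<rho>}. \<eta>geom \<mu> - ereal (4 * q \<mu>)"
  assumes I: "open I" "J \<subseteq> I"
    and J: "\<mu>c \<in> interior J"
    and smooth: "smooth_on (UNIV \<times> I) (\<lambda>(x, \<mu>). f x \<mu>)"
    and hopf: "supercritical_hopf f \<mu>c xs"
    and equilibria: "\<And>\<mu>. \<mu> \<in> J \<Longrightarrow> \<mu> < \<mu>c \<Longrightarrow> stable_equilibrium (\<lambda>x. f x \<mu>) (xs \<mu>)"
    and orbits: "\<And>\<mu>. \<mu> \<in> J \<Longrightarrow> \<mu> > \<mu>c \<Longrightarrow> stable_periodic_orbit (\<lambda>x. f x \<mu>) (\<Gamma> \<mu>)"
    and branch: "((\<lambda>\<mu>. hausdorff_dist (\<Gamma> \<mu>) {xs \<mu>c}) \<longlongrightarrow> 0) (at_right \<mu>c)"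
    and delay: "\<tau> > 0"
    and embedding: "\<And>\<mu>. \<mu> \<in> J \<Longrightarrow> \<mu> \<noteq> \<mu>c \<Longrightarrow> smooth_embedding_on (A \<mu>) (\<Phi> \<mu>)"
    and sample_finite: "\<And>\<mu>. \<mu> \<in> J \<Longrightarrow> \<mu> > \<mu>c \<Longrightarrow> finite (P \<mu>) \<and> P \<mu> \<noteq> {} \<and> P \<mu> \<subseteq> M \<mu>"
    and sample_dense: "\<And>\<mu>. \<mu> \<in> J \<Longrightarrow> \<mu> > \<mu>c \<Longrightarrow> hausdorff_dist (P \<mu>) (M \<mu>) \<le> \<delta> \<mu>"
    and reach_pos: "\<And>\<mu>. \<mu> \<in> J \<Longrightarrow> \<mu> > \<mu>c \<Longrightarrow> R \<mu> > 0"
    and sample_reach: "\<And>\<mu>. \<mu> \<in> J \<Longrightarrow> \<mu> > \<mu>c \<Longrightarrow> ereal (\<delta> \<mu>) < ereal (1/2 * sqrt (3/10)) * R \<mu>"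
    and sample_point: "\<And>\<mu>. \<mu> \<in> J \<Longrightarrow> \<mu> < \<mu>c \<Longrightarrow> P \<mu> = M \<mu>"
    and cloud_finite: "\<And>\<mu>. \<mu> \<in> J \<Longrightarrow> \<mu> \<noteq> \<mu>c \<Longrightarrow> finite (X \<mu>) \<and> X \<mu> \<noteq> {}"
    and cloud_close: "\<And>\<mu>. \<mu> \<in> J \<Longrightarrow> \<mu> \<noteq> \<mu>c \<Longrightarrow> hausdorff_dist (P \<mu>) (X \<mu>) \<le> q \<mu>"
    and window: "0 < \<Delta>" "\<Delta> < \<rho>" "{\<mu>c - \<rho>..\<mu>c - \<Delta>} \<subseteq> J" "{\<mu>c + \<Delta>..\<mu>c + \<rho>} \<subseteq> J"
    and finite_Bminus: "Bminus < \<infinity>"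
    and gap: "Bminus < Bplus"
  shows "\<forall>\<eta>::real. Bminus < ereal \<eta> \<and> ereal \<eta> < Bplus \<longrightarrow>
      (\<forall>\<mu>\<in>{\<mu>c - \<rho>..\<mu>c - \<Delta>}. dominant_functional (X \<mu>) < \<eta>) \<and>
      (\<forall>\<mu>\<in>{\<mu>c + \<Delta>..\<mu>c + \<rho>}. dominant_functional (X \<mu>) > \<eta>)"
proof (intro allI impI)
  fix \<eta> :: real
  assume "Bminus < ereal \<eta> \<and> ereal \<eta> < Bplus"
  then have lower: "Bminus < ereal \<eta>" and upper: "ereal \<eta> < Bplus" by auto
  have q: "4 * q \<mu> < \<eta>" if "\<mu> \<in> {\<mu>c - \<rho>..\<mu>c - \<Delta>}" for \<mu>
  proof -
    have "ereal (4 * q \<mu>) \<le> Bminus" unfolding Bminus_def using that by (rule SUP_upper)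
    then have "ereal (4 * q \<mu>) < ereal \<eta>" using lower by (rule order.strict_trans1)
    then show ?thesis by simp
  qed
  have point: "0 \<le> q \<mu>" "dominant_functional (X \<mu>) \<le> 2 * q \<mu>"
    if "\<mu> \<in> {\<mu>c - \<rho>..\<mu>c - \<Delta>}" for \<mu>
  proof -
    have "\<mu> \<in> J" "\<mu> < \<mu>c" using that window by auto
    then have X: "finite (X \<mu>)" "X \<mu> \<noteq> {}" using cloud_finite by auto
    define p where "p = \<Phi> \<mu> (xs \<mu>)"
    have "P \<mu> = {p}"
      using sample_point[OF \<open>\<mu> \<in> J\<close> \<open>\<mu> < \<mu>c\<close>] \<open>\<mu> < \<mu>c\<close> by (simp add: M_def A_def p_def)
    moreover have "hausdorff_dist (P \<mu>) (X \<mu>) \<le> q \<mu>"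
      using cloud_close[OF \<open>\<mu> \<in> J\<close>] \<open>\<mu> < \<mu>c\<close> by simp
    ultimately have haus: "hausdorff_dist (X \<mu>) {p} \<le> q \<mu>"
      by (simp add: hausdorff_dist_commute[of "X \<mu>"])
    have near: "dist x p \<le> q \<mu>" if "x \<in> X \<mu>" for x
      using infdist_le_hausdorff_dist[OF finite_imp_bounded[OF X(1)] that, of "{p}"] haus by simp
    show "0 \<le> q \<mu>" using near X(2) zero_le_dist order_trans by (metis ex_in_conv)
    moreover have "dist x y \<le> 2 * q \<mu>" if "x \<in> X \<mu>" "y \<in> X \<mu>" for x y
      using near[OF that(1)] near[OF that(2)] dist_triangle2[of x y p] by simp
    ultimately show "dominant_functional (X \<mu>) \<le> 2 * q \<mu>"
      using X(1) by (intro dominant_functional_le_diameter) auto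
  qed
  \<comment> \<open>The window before the bifurcation is not empty, which makes the threshold nonnegative.\<close>
  have "\<mu>c - \<rho> \<in> {\<mu>c - \<rho>..\<mu>c - \<Delta>}" using window(2) by simp
  from q[OF this] point(1)[OF this] have "0 \<le> \<eta>" by simp
  show "(\<forall>\<mu>\<in>{\<mu>c - \<rho>..\<mu>c - \<Delta>}. dominant_functional (X \<mu>) < \<eta>) \<and>
      (\<forall>\<mu>\<in>{\<mu>c + \<Delta>..\<mu>c + \<rho>}. dominant_functional (X \<mu>) > \<eta>)"
  proof (intro conjI ballI)
    fix \<mu> assume "\<mu> \<in> {\<mu>c - \<rho>..\<mu>c - \<Delta>}"
    from q[OF this] point[OF this] show "dominant_functional (X \<mu>) < \<eta>" by simp
  next
    fix \<mu> assume \<mu>: "\<mu> \<in> {\<mu>c + \<Delta>..\<mu>c + \<rho>}"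
    then have J: "\<mu> \<in> J" "\<mu> > \<mu>c" "\<mu> \<noteq> \<mu>c" using window by auto
    have "periodic_orbit (\<lambda>x. f x \<mu>) (\<Gamma> \<mu>)"
      using orbits[OF J(1,2)] by (simp add: stable_periodic_orbit_def)
    then obtain \<gamma> :: "real \<Rightarrow> real^'n"
      where \<gamma>: "continuous_on {0..1} \<gamma>" "inj_on \<gamma> {0..<1}" "\<gamma> 1 = \<gamma> 0"
      "\<Gamma> \<mu> = \<gamma> ` {0..1}" by (rule periodic_orbit_parametrization)
    have A: "A \<mu> = \<Gamma> \<mu>" using J(2) by (simp add: A_def)
    have \<Phi>: "continuous_on (\<Gamma> \<mu>) (\<Phi> \<mu>)" "inj_on (\<Phi> \<mu>) (\<Gamma> \<mu>)"
    proof -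
      obtain \<Psi> where "homeomorphism (A \<mu>) (\<Phi> \<mu> ` A \<mu>) (\<Phi> \<mu>) \<Psi>"
        using embedding[OF J(1,3)] unfolding smooth_embedding_on_def by blast
      then show "continuous_on (\<Gamma> \<mu>) (\<Phi> \<mu>)" "inj_on (\<Phi> \<mu>) (\<Gamma> \<mu>)"
        unfolding homeomorphism_def A by (auto intro: inj_on_inverseI)
    qed
    define \<gamma>' where "\<gamma>' t = \<Phi> \<mu> (\<gamma> t)" for t
    have \<gamma>': "continuous_on {0..1} \<gamma>'" "inj_on \<gamma>' {0..<1}" "\<gamma>' 1 = \<gamma>' 0" "M \<mu> = \<gamma>' ` {0..1}"
    proof -
      show "continuous_on {0..1} \<gamma>'"
        unfolding \<gamma>'_def
        by (rule continuous_on_compose2[OF \<Phi>(1) \<gamma>(1)]) (simp add: \<gamma>(4))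
      show "inj_on \<gamma>' {0..<1}"
      proof (rule inj_onI)
        fix s t :: real assume st: "s \<in> {0..<1}" "t \<in> {0..<1}" "\<gamma>' s = \<gamma>' t"
        then have "\<gamma> s \<in> \<Gamma> \<mu>" "\<gamma> t \<in> \<Gamma> \<mu>" unfolding \<gamma>(4) by auto
        then have "\<gamma> s = \<gamma> t" using inj_onD[OF \<Phi>(2)] st(3) unfolding \<gamma>'_def by blast
        then show "s = t" using inj_onD[OF \<gamma>(2)] st(1,2) by blast
      qed
      show "\<gamma>' 1 = \<gamma>' 0" by (simp add: \<gamma>'_def \<gamma>(3))
      show "M \<mu> = \<gamma>' ` {0..1}" by (simp add: M_def A \<gamma>(4) image_image \<gamma>'_def)
    qed
    have compactM: "compact (M \<mu>)"
      unfolding \<gamma>'(4) using \<gamma>'(1) by (intro compact_continuous_image compact_Icc)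
    have P: "finite (P \<mu>)" "P \<mu> \<noteq> {}" "P \<mu> \<subseteq> M \<mu>" using sample_finite[OF J(1,2)] by auto
    have X: "finite (X \<mu>)" "X \<mu> \<noteq> {}" using cloud_finite[OF J(1,3)] by auto
    have dense: "\<exists>p\<in>P \<mu>. dist m p \<le> \<delta> \<mu>" if "m \<in> M \<mu>" for m
      using sample_dense[OF J(1,2)] that P compactM
      by (intro hausdorff_near_point[of "M \<mu>"])
        (auto simp: hausdorff_dist_commute finite_imp_closed compact_imp_bounded)
    have PX: "\<exists>x\<in>X \<mu>. dist p x \<le> q \<mu>" if "p \<in> P \<mu>" for p
      using cloud_close[OF J(1,3)] that P X
      by (intro hausdorff_near_point[of "P \<mu>"]) (auto simp: finite_imp_closed finite_imp_bounded)
    have XP: "\<exists>p\<in>P \<mu>. dist x p \<le> q \<mu>" if "x \<in> X \<mu>" for x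
      using cloud_close[OF J(1,3)] that P X
      by (intro hausdorff_near_point[of "X \<mu>"])
        (auto simp: hausdorff_dist_commute finite_imp_closed finite_imp_bounded)
    have nonneg: "0 \<le> \<delta> \<mu>" "0 \<le> q \<mu>"
      using dense PX P(2,3) zero_le_dist order_trans by (meson ex_in_conv subsetD)+
    define \<kappa> where "\<kappa> = \<delta> \<mu> + q \<mu>"
    \<comment> \<open>The reach is an extended real; all that is needed is a radius below it that still fits.\<close>
    have "ereal \<eta> < 2 * (ereal (sqrt (3/10)) * R \<mu> - ereal (2 * \<delta> \<mu>)) - ereal (4 * q \<mu>)"
    proof -
      have "Bplus \<le> \<eta>geom \<mu> - ereal (4 * q \<mu>)" unfolding Bplus_def using \<mu> by (rule INF_lower)
      with upper show ?thesis unfolding \<eta>geom_def by (rule order.strict_trans2)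
    qed
    then have "ereal ((\<eta> + 4 * \<kappa>) / (2 * sqrt (3/10))) < R \<mu>"
      using reach_pos[OF J(1,2)]
      by (cases "R \<mu>") (auto simp: \<kappa>_def field_simps)
    then obtain r where r: "ereal ((\<eta> + 4 * \<kappa>) / (2 * sqrt (3/10))) < ereal r" "ereal r < R \<mu>"
      using ereal_dense2 by blast
    show "dominant_functional (X \<mu>) > \<eta>"
    proof (rule dominant_functional_near_closed_curve[OF \<gamma>' X(1)])
      show "ereal r < reach (M \<mu>)" using r(2) by (simp add: R_def)
      show "\<eta> + 4 * \<kappa> < 2 * sqrt (3/10) * r" using r(1) by (simp add: field_simps)
      show "0 \<le> \<kappa>" "0 \<le> \<eta>" using nonneg \<open>0 \<le> \<eta>\<close> by (simp_all add: \<kappa>_def)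
      show "infdist x (M \<mu>) \<le> \<kappa>" if "x \<in> X \<mu>" for x
      proof -
        from XP[OF that] obtain p where "p \<in> P \<mu>" "dist x p \<le> q \<mu>" by blast
        then show ?thesis using infdist_le[of p "M \<mu>" x] P(3) nonneg by (auto simp: \<kappa>_def)
      qed
      show "\<exists>x\<in>X \<mu>. dist m x \<le> \<kappa>" if "m \<in> M \<mu>" for m
      proof -
        from dense[OF that] obtain p where p: "p \<in> P \<mu>" "dist m p \<le> \<delta> \<mu>" by blast
        obtain x where x: "x \<in> X \<mu>" "dist p x \<le> q \<mu>" using PX[OF p(1)] by blast
        have "dist m x \<le> \<kappa>"
          using dist_triangle[of m x p] p(2) x(2) by (simp add: \<kappa>_def)
        then show ?thesis using x(1) by blast
      qed
    qed
  qed
qed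

end
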